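(* Let $T$ be a tree with $n$ vertices and diameter $d \geq 3$. For $0 \leq \alpha < 1$, $\rho_\alpha(T) \leq \rho_\alpha(T_{n,d})$, with equality if and only if $T \cong T_{n,d}$.
   Context: All graphs are finite, simple and undirected. For a graph $G$, $A(G)$ is its adjacency matrix and $D(G)$ the diagonal matrix of vertex degrees. For $\alpha\in[0,1]$, $A_\alpha(G) = \alpha D(G) + (1-\alpha)A(G)$, and $\rho_\alpha(G)$ is the largest eigenvalue of $A_\alpha(G)$. For $3 \leq d \leq n-1$, $T_{n,d}$ is the tree obtained from a path $v_0v_1\cdots v_d$ of length $d$ by attaching $n-1-d$ pendant edges at the vertex $v_{\lfloor d/2 \rfloor}$. *)

theory Defs
  imports
    "Graph_Theory.Digraph_Component"
    "Graph_Theory.Digraph_Isomorphism"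
    "Graph_Theory.Shortest_Path"
    "Jordan_Normal_Form.Spectral_Radius"
begin

text \<open>
  Finite simple undirected graphs are loop-free symmetric pair digraphs (locale \<^locale>\<open>pair_graph\<close>):
  an edge $uv$ is the pair of arcs $(u,v)$ and $(v,u)$.

  \<^const>\<open>Digraph_Component.tree\<close> is not usable for them, since there the arcs $(u,v),(v,u)$ of a
  single edge already form a cycle.  In a simple undirected graph, cycles are those of length at
  least 3.
\<close>

definition undirected_tree :: "'a pair_pre_digraph \<Rightarrow> bool" where
  "undirected_tree G \<longleftrightarrow> pair_graph G \<and> Digraph_Component.connected (with_proj G) \<and>
     \<not> (\<exists>p. pre_digraph.cycle (with_proj G) p \<and> 3 \<le> length p)"

text \<open>With unit weights, \<open>\<mu>\<close> is the usual distance, with value \<open>\<infinity>\<close> between different components.\<close>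

definition graph_diameter :: "'a pair_pre_digraph \<Rightarrow> ereal" where
  "graph_diameter G =
     (SUP u\<in>pverts G. SUP v\<in>pverts G. wf_digraph.\<mu> (with_proj G) (\<lambda>_. 1) u v)"

text \<open>
  The matrices are indexed by positions in a fixed enumeration of the vertices.  Another enumeration
  conjugates them by a permutation matrix, so the spectrum does not depend on the choice.
\<close>

definition vertex_list :: "'a pair_pre_digraph \<Rightarrow> 'a list" where
  "vertex_list G = (SOME vs. distinct vs \<and> set vs = pverts G)"

definition adjacency_matrix :: "'a pair_pre_digraph \<Rightarrow> real mat" where
  "adjacency_matrix G = (let vs = vertex_list G; n = card (pverts G) in
     Matrix.mat n n (\<lambda>(i, j). if (vs ! i, vs ! j) \<in> parcs G then 1 else 0))"

text \<open>As the arc set is symmetric, the degree of a vertex is its out-degree.\<close>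

definition degree_matrix :: "'a pair_pre_digraph \<Rightarrow> real mat" where
  "degree_matrix G = mat_diag (card (pverts G))
     (\<lambda>i. real (out_degree (with_proj G) (vertex_list G ! i)))"

definition A_alpha :: "real \<Rightarrow> 'a pair_pre_digraph \<Rightarrow> real mat" where
  "A_alpha \<alpha> G = \<alpha> \<cdot>\<^sub>m degree_matrix G + (1 - \<alpha>) \<cdot>\<^sub>m adjacency_matrix G"

text \<open>The matrix is real symmetric, so all its eigenvalues are real.\<close>

definition rho :: "real \<Rightarrow> 'a pair_pre_digraph \<Rightarrow> real" where
  "rho \<alpha> G = Max {k. eigenvalue (A_alpha \<alpha> G) k}"

text \<open>
  The path $v_0 \ldots v_d$ is $0, \ldots, d$; the pendant vertices are $d+1, \ldots, n-1$.
  Meaningful for $3 \le d \le n-1$.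
\<close>

definition T_tree :: "nat \<Rightarrow> nat \<Rightarrow> nat pair_pre_digraph" where
  "T_tree n d = \<lparr> pverts = {0..<n},
     parcs = symcl ({(i, Suc i) |i. i < d} \<union> {(d div 2, j) |j. d < j \<and> j < n}) \<rparr>"

end

theory Submission
  imports Defs "HOL-Analysis.Function_Topology"
begin

text \<open>
  $\rho_\alpha$ is the maximum of the Rayleigh quotient of $A_\alpha$, and on a connected graph it is
  attained at a positive vector $x$.

  Let $z$ be a vertex of the tree where $x$ is largest and root the tree at $z$.  A path
  $v_0 \ldots v_d$ climbs towards $z$ up to some $v_i$ and descends afterwards.  Making every vertex
  a child of $z$, except the $v_j$ with $|j - i| \ge 2$, does not decrease the quadratic form at $x$, and
  yields a path of length $d$ with all other vertices pendant at one inner vertex.  If the maximum did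
  not change, then $x$ is an eigenvector of both trees, and comparing the two eigenvalue equations at
  $z$ shows that nothing was moved.

  It remains to move the centre of such a tree from $v_i$ to $v_m$, where $i < m = \lfloor d/2 \rfloor$.  If
  $x(v_i) \le x(v_m)$, move the pendant vertices.  Otherwise reverse a segment
  $v_{i-t} \ldots v_{m+t}$ of the path.  This carries $v_i$ to position $m$, and it does not decrease
  the form for the first $t$ at which either $i - t = 0$ or $x(v_{i-t-1}) \le x(v_{m+t+1})$.
\<close>

section \<open>Symmetric kernels on finite sets\<close>

definition inner_on :: "'a set \<Rightarrow> ('a \<Rightarrow> real) \<Rightarrow> ('a \<Rightarrow> real) \<Rightarrow> real" where
  "inner_on V x y = (\<Sum>v\<in>V. x v * y v)"

definition kernel_op :: "'a set \<Rightarrow> ('a \<Rightarrow> 'a \<Rightarrow> real) \<Rightarrow> ('a \<Rightarrow> real) \<Rightarrow> 'a \<Rightarrow> real" where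
  "kernel_op V K x v = (\<Sum>w\<in>V. K v w * x w)"

definition kernel_form :: "'a set \<Rightarrow> ('a \<Rightarrow> 'a \<Rightarrow> real) \<Rightarrow> ('a \<Rightarrow> real) \<Rightarrow> real" where
  "kernel_form V K x = inner_on V x (kernel_op V K x)"

definition kernel_eigenvalue :: "'a set \<Rightarrow> ('a \<Rightarrow> 'a \<Rightarrow> real) \<Rightarrow> real \<Rightarrow> bool" where
  "kernel_eigenvalue V K k \<longleftrightarrow>
     (\<exists>x. (\<exists>v\<in>V. x v \<noteq> 0) \<and> (\<forall>v\<in>V. kernel_op V K x v = k * x v))"

definition top_eigenvalue :: "'a set \<Rightarrow> ('a \<Rightarrow> 'a \<Rightarrow> real) \<Rightarrow> real" where
  "top_eigenvalue V K = Max {k. kernel_eigenvalue V K k}"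

definition top_eigenvector :: "'a set \<Rightarrow> ('a \<Rightarrow> 'a \<Rightarrow> real) \<Rightarrow> ('a \<Rightarrow> real) \<Rightarrow> bool" where
  "top_eigenvector V K x \<longleftrightarrow>
     (\<exists>v\<in>V. x v \<noteq> 0) \<and> (\<forall>v\<in>V. kernel_op V K x v = top_eigenvalue V K * x v)"

lemma inner_on_add_scale:
  "inner_on V x (\<lambda>v. y v + t * z v) = inner_on V x y + t * inner_on V x z"
  by (simp add: inner_on_def sum.distrib sum_distrib_left algebra_simps)

lemma inner_on_commute: "inner_on V x y = inner_on V y x"
  by (simp add: inner_on_def mult.commute)

lemma inner_on_cong:
  "(\<And>v. v \<in> V \<Longrightarrow> x v = x' v) \<Longrightarrow> (\<And>v. v \<in> V \<Longrightarrow> y v = y' v) \<Longrightarrow> inner_on V x y = inner_on V x' y'"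
  by (simp add: inner_on_def)

lemma inner_on_self_nonneg: "0 \<le> inner_on V x x"
  by (simp add: inner_on_def sum_nonneg)

lemma inner_on_self_eq_0_iff:
  assumes "finite V"
  shows "inner_on V x x = 0 \<longleftrightarrow> (\<forall>v\<in>V. x v = 0)"
  using assms by (simp add: inner_on_def sum_nonneg_eq_0_iff)

lemma inner_on_self_pos:
  assumes "finite V" "\<exists>v\<in>V. x v \<noteq> 0"
  shows "0 < inner_on V x x"
  using assms inner_on_self_nonneg[of V x] inner_on_self_eq_0_iff[of V x] by fastforce

lemma inner_on_reindex: "bij_betw f V W \<Longrightarrow> inner_on W x y = inner_on V (x \<circ> f) (y \<circ> f)"
  by (simp add: inner_on_def sum.reindex_bij_betw[symmetric])

lemma kernel_op_add_scale:
  "kernel_op V K (\<lambda>v. x v + t * y v) = (\<lambda>v. kernel_op V K x v + t * kernel_op V K y v)"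
  by (simp add: kernel_op_def fun_eq_iff sum.distrib sum_distrib_left algebra_simps)

lemma kernel_op_cong: "(\<And>v. v \<in> V \<Longrightarrow> x v = x' v) \<Longrightarrow> kernel_op V K x = kernel_op V K x'"
  by (simp add: kernel_op_def fun_eq_iff)

lemma kernel_form_cong: "(\<And>v. v \<in> V \<Longrightarrow> x v = x' v) \<Longrightarrow> kernel_form V K x = kernel_form V K x'"
  unfolding kernel_form_def using kernel_op_cong[of V x x' K] by (auto intro: inner_on_cong)

lemma kernel_form_scale: "kernel_form V K (\<lambda>v. t * x v) = t\<^sup>2 * kernel_form V K x"
  by (simp add: kernel_form_def inner_on_def kernel_op_def sum_distrib_left power2_eq_square ac_simps)

lemma inner_on_self_scale: "inner_on V (\<lambda>v. t * x v) (\<lambda>v. t * x v) = t\<^sup>2 * inner_on V x x"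
  by (simp add: inner_on_def sum_distrib_left power2_eq_square ac_simps)

lemma kernel_form_eq_sum: "kernel_form V K x = (\<Sum>v\<in>V. \<Sum>w\<in>V. K v w * x v * x w)"
  by (simp add: kernel_form_def inner_on_def kernel_op_def sum_distrib_left ac_simps)

lemma kernel_form_eigenvector:
  assumes "\<And>v. v \<in> V \<Longrightarrow> kernel_op V K x v = k * x v"
  shows "kernel_form V K x = k * inner_on V x x"
  using assms by (simp add: kernel_form_def inner_on_def sum_distrib_left ac_simps)

lemma eigenvector_mat_iff:
  "eigenvector (Matrix.mat n n (\<lambda>(i, j). K i j)) w k \<longleftrightarrow>
     w \<in> carrier_vec n \<and> (\<exists>i<n. w $ i \<noteq> 0) \<and> (\<forall>i<n. kernel_op {..<n} K (($) w) i = k * w $ i)"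
proof (cases "w \<in> carrier_vec n")
  case True
  let ?M = "Matrix.mat n n (\<lambda>(i, j). K i j)"
  have "(?M *\<^sub>v w) $ i = kernel_op {..<n} K (($) w) i" if "i < n" for i
    using that True by (simp add: scalar_prod_def kernel_op_def lessThan_atLeast0)
  then have "?M *\<^sub>v w = k \<cdot>\<^sub>v w \<longleftrightarrow> (\<forall>i<n. kernel_op {..<n} K (($) w) i = k * w $ i)"
    using True by (simp add: vec_eq_iff)
  moreover have "w \<noteq> 0\<^sub>v n \<longleftrightarrow> (\<exists>i<n. w $ i \<noteq> 0)"
    using True by (simp add: vec_eq_iff)
  ultimately show ?thesis
    by (simp add: eigenvector_def)
qed (simp add: eigenvector_def)

lemma eigenvalue_mat_iff:
  "eigenvalue (Matrix.mat n n (\<lambda>(i, j). K i j)) k \<longleftrightarrow> kernel_eigenvalue {..<n} K k"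
proof
  assume "eigenvalue (Matrix.mat n n (\<lambda>(i, j). K i j)) k"
  then obtain w where "eigenvector (Matrix.mat n n (\<lambda>(i, j). K i j)) w k"
    by (auto simp: eigenvalue_def)
  then show "kernel_eigenvalue {..<n} K k"
    unfolding eigenvector_mat_iff kernel_eigenvalue_def by (intro exI[of _ "($) w"]) auto
next
  assume "kernel_eigenvalue {..<n} K k"
  then obtain x where "\<exists>i<n. x i \<noteq> 0" "\<forall>i<n. kernel_op {..<n} K x i = k * x i"
    by (auto simp: kernel_eigenvalue_def)
  moreover have "kernel_op {..<n} K (($) (vec n x)) = kernel_op {..<n} K x"
    by (rule kernel_op_cong) simp
  ultimately have "eigenvector (Matrix.mat n n (\<lambda>(i, j). K i j)) (vec n x) k"
    unfolding eigenvector_mat_iff by auto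
  then show "eigenvalue (Matrix.mat n n (\<lambda>(i, j). K i j)) k"
    by (auto simp: eigenvalue_def)
qed

lemma kernel_op_reindex:
  assumes "bij_betw f V W" "\<And>u v. u \<in> V \<Longrightarrow> v \<in> V \<Longrightarrow> L (f u) (f v) = K u v" "v \<in> V"
  shows "kernel_op W L x (f v) = kernel_op V K (x \<circ> f) v"
  using assms by (simp add: kernel_op_def sum.reindex_bij_betw[OF assms(1), symmetric])

lemma kernel_eigenvalue_pullback:
  assumes bij: "bij_betw f V W"
    and kernels: "\<And>u v. u \<in> V \<Longrightarrow> v \<in> V \<Longrightarrow> L (f u) (f v) = K u v"
    and eigen: "kernel_eigenvalue W L k"
  shows "kernel_eigenvalue V K k"
proof -
  obtain x where eigenvector: "\<exists>w\<in>W. x w \<noteq> 0" "\<forall>w\<in>W. kernel_op W L x w = k * x w"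
    using eigen by (auto simp: kernel_eigenvalue_def)
  have image_eq: "W = f ` V"
    using bij by (simp add: bij_betw_def)
  have "\<exists>v\<in>V. (x \<circ> f) v \<noteq> 0"
    using eigenvector(1) image_eq by auto
  moreover have "\<forall>v\<in>V. kernel_op V K (x \<circ> f) v = k * (x \<circ> f) v"
    using eigenvector(2) image_eq kernel_op_reindex[where L = L and K = K, OF bij kernels, of _ x]
    by auto
  ultimately show ?thesis
    unfolding kernel_eigenvalue_def by blast
qed

lemma kernel_eigenvalue_reindex:
  assumes bij: "bij_betw f V W"
    and kernels: "\<And>u v. u \<in> V \<Longrightarrow> v \<in> V \<Longrightarrow> L (f u) (f v) = K u v"
  shows "kernel_eigenvalue W L = kernel_eigenvalue V K"
proof (intro ext iffI)
  let ?g = "the_inv_into V f"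
  have bij_inverse: "bij_betw ?g W V"
    using bij by (rule bij_betw_the_inv_into)
  have "K (?g u) (?g v) = L u v" if "u \<in> W" "v \<in> W" for u v
    using that bij bij_inverse kernels[of "?g u" "?g v"]
    by (simp add: f_the_inv_into_f_bij_betw bij_betw_apply)
  then show "kernel_eigenvalue W L k" if "kernel_eigenvalue V K k" for k
    using kernel_eigenvalue_pullback[where K = L and L = K, OF bij_inverse _ that] by blast
qed (rule kernel_eigenvalue_pullback[where K = K and L = L, OF bij kernels])

lemma finite_kernel_eigenvalues:
  assumes "finite V"
  shows "finite {k. kernel_eigenvalue V K k}"
proof -
  let ?n = "card V"
  obtain f where bij: "bij_betw f {..<?n} V"
    using ex_bij_betw_nat_finite[OF assms] by (auto simp: lessThan_atLeast0)
  define M where "M = Matrix.mat ?n ?n (\<lambda>(i, j). K (f i) (f j))"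
  have "{k. kernel_eigenvalue V K k} = spectrum M"
    unfolding spectrum_def M_def eigenvalue_mat_iff by (simp add: kernel_eigenvalue_reindex[OF bij])
  moreover have "finite (spectrum M)"
    by (rule card_finite_spectrum(1)[of _ ?n]) (simp add: M_def)
  ultimately show ?thesis
    by simp
qed

definition unit_sphere :: "'a set \<Rightarrow> ('a \<Rightarrow> real) set" where
  "unit_sphere V = {x. (\<forall>v. v \<notin> V \<longrightarrow> x v = 0) \<and> inner_on V x x = 1}"

lemma compact_unit_sphere:
  fixes V :: "'a set"
  assumes "finite V"
  shows "compact (unit_sphere V)"
proof -
  define B :: "('a \<Rightarrow> real) set" where "B = PiE UNIV (\<lambda>v. if v \<in> V then {-1..1} else {0})"
  have "compactin (product_topology (\<lambda>v::'a. euclidean :: real topology) UNIV) B"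
    unfolding B_def by (simp add: compactin_PiE)
  then have "compact B"
    by (simp add: euclidean_product_topology)
  moreover have "closed {x. inner_on V x x = 1}"
    unfolding inner_on_def
    by (intro closed_Collect_eq continuous_intros continuous_on_product_coordinates)
  ultimately have "compact (B \<inter> {x. inner_on V x x = 1})"
    by (rule compact_Int_closed)
  moreover have "unit_sphere V = B \<inter> {x. inner_on V x x = 1}"
  proof -
    have "\<bar>x v\<bar> \<le> 1" if "inner_on V x x = 1" "v \<in> V" for x :: "'a \<Rightarrow> real" and v
      using member_le_sum[of v V "\<lambda>v. (x v)\<^sup>2"] that assms
      by (simp add: inner_on_def abs_square_le_1 flip: power2_eq_square)
    then show ?thesis
      by (auto simp: unit_sphere_def B_def PiE_iff abs_le_iff minus_le_iff split: if_splits)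
  qed
  ultimately show ?thesis
    by simp
qed

definition normalise :: "'a set \<Rightarrow> ('a \<Rightarrow> real) \<Rightarrow> 'a \<Rightarrow> real" where
  "normalise V x v = (if v \<in> V then x v / sqrt (inner_on V x x) else 0)"

lemma normalise_in_unit_sphere:
  assumes "finite V" "\<exists>v\<in>V. x v \<noteq> 0"
  shows "normalise V x \<in> unit_sphere V"
proof -
  have "inner_on V (normalise V x) (normalise V x) =
      inner_on V (\<lambda>v. 1 / sqrt (inner_on V x x) * x v) (\<lambda>v. 1 / sqrt (inner_on V x x) * x v)"
    by (rule inner_on_cong) (simp_all add: normalise_def)
  also have "\<dots> = 1"
    unfolding inner_on_self_scale using inner_on_self_pos[OF assms] by (simp add: power_divide)
  finally show ?thesis
    by (simp add: unit_sphere_def normalise_def)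
qed

lemma kernel_form_normalise: "kernel_form V K (normalise V x) = kernel_form V K x / inner_on V x x"
proof -
  have "kernel_form V K (normalise V x) = kernel_form V K (\<lambda>v. 1 / sqrt (inner_on V x x) * x v)"
    by (rule kernel_form_cong) (simp add: normalise_def)
  also have "\<dots> = kernel_form V K x / inner_on V x x"
    unfolding kernel_form_scale using inner_on_self_nonneg[of V x] by (simp add: power_divide)
  finally show ?thesis .
qed

lemma linear_term_eq_0:
  fixes b c :: real
  assumes "\<And>t. 2 * t * b \<le> t\<^sup>2 * c"
  shows "b = 0"
proof (rule ccontr)
  assume "b \<noteq> 0"
  define t where "t = b / (1 + \<bar>c\<bar>)"
  have "2 * t * b \<le> t\<^sup>2 * c"
    by (rule assms)
  also have "\<dots> \<le> t\<^sup>2 * (1 + \<bar>c\<bar>)"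
    by (intro mult_left_mono) auto
  also have "\<dots> = t * b"
    by (simp add: t_def power2_eq_square)
  finally have "t * b \<le> 0"
    by (simp add: mult.commute)
  moreover have "t * b > 0"
    using \<open>b \<noteq> 0\<close> by (auto simp: t_def zero_less_divide_iff zero_less_mult_iff linorder_neq_iff)
  ultimately show False
    by simp
qed

locale symmetric_kernel =
  fixes V :: "'a set" and K :: "'a \<Rightarrow> 'a \<Rightarrow> real"
  assumes finite_V: "finite V" and nonempty_V: "V \<noteq> {}"
    and kernel_sym: "u \<in> V \<Longrightarrow> v \<in> V \<Longrightarrow> K u v = K v u"
begin

lemma kernel_op_self_adjoint: "inner_on V x (kernel_op V K y) = inner_on V y (kernel_op V K x)"
proof -
  have "(\<Sum>u\<in>V. \<Sum>v\<in>V. x u * (K u v * y v)) = (\<Sum>v\<in>V. \<Sum>u\<in>V. x u * (K u v * y v))"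
    by (rule sum.swap)
  also have "\<dots> = (\<Sum>v\<in>V. \<Sum>u\<in>V. y v * (K v u * x u))"
    by (intro sum.cong refl) (simp add: kernel_sym)
  finally show ?thesis
    by (simp add: inner_on_def kernel_op_def sum_distrib_left)
qed

lemma kernel_form_add_scale:
  "kernel_form V K (\<lambda>v. x v + t * y v) =
   kernel_form V K x + 2 * t * inner_on V y (kernel_op V K x) + t\<^sup>2 * kernel_form V K y"
  using kernel_op_self_adjoint[of x y]
  by (simp add: kernel_form_def kernel_op_add_scale inner_on_add_scale
      inner_on_commute[of V "\<lambda>v. x v + t * y v"] inner_on_commute[of V "kernel_op V K x"]
      inner_on_commute[of V "kernel_op V K y"] power2_eq_square algebra_simps)

lemma rayleigh_maximiser_eigenvector:
  assumes bound: "\<And>y. kernel_form V K y \<le> \<rho> * inner_on V y y"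
    and attained: "kernel_form V K x = \<rho> * inner_on V x x" and "v \<in> V"
  shows "kernel_op V K x v = \<rho> * x v"
proof -
  define r where "r v = kernel_op V K x v + (- \<rho>) * x v" for v
  have residual: "inner_on V r (kernel_op V K x) - \<rho> * inner_on V r x = inner_on V r r"
    using inner_on_add_scale[of V r "kernel_op V K x" "- \<rho>" x] unfolding r_def[symmetric] by simp
  have "2 * t * inner_on V r r \<le> t\<^sup>2 * (\<rho> * inner_on V r r - kernel_form V K r)" for t
  proof -
    have "inner_on V (\<lambda>v. x v + t * r v) (\<lambda>v. x v + t * r v) =
        inner_on V x x + 2 * t * inner_on V r x + t\<^sup>2 * inner_on V r r"
      by (simp add: inner_on_add_scale inner_on_commute[of V "\<lambda>v. x v + t * r v"]
          inner_on_commute[of V x r] power2_eq_square algebra_simps)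
    then have "2 * t * (inner_on V r (kernel_op V K x) - \<rho> * inner_on V r x) \<le>
        t\<^sup>2 * (\<rho> * inner_on V r r - kernel_form V K r)"
      using bound[of "\<lambda>v. x v + t * r v"] attained
      by (simp add: kernel_form_add_scale algebra_simps)
    then show ?thesis
      by (simp only: residual)
  qed
  then have "inner_on V r r = 0"
    by (rule linear_term_eq_0)
  then show ?thesis
    using \<open>v \<in> V\<close> finite_V by (simp add: inner_on_self_eq_0_iff r_def)
qed

lemma ex_rayleigh_maximiser:
  "\<exists>x. inner_on V x x = 1 \<and> (\<forall>y. kernel_form V K y \<le> kernel_form V K x * inner_on V y y)"
proof -
  have "unit_sphere V \<noteq> {}"
    using normalise_in_unit_sphere[OF finite_V, of "\<lambda>_. 1"] nonempty_V by force
  moreover have "continuous_on (unit_sphere V) (kernel_form V K)"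
    unfolding kernel_form_eq_sum
    by (intro continuous_intros continuous_on_subset[OF continuous_on_product_coordinates] subset_UNIV)
  ultimately obtain x where maximum: "x \<in> unit_sphere V"
    "\<And>z. z \<in> unit_sphere V \<Longrightarrow> kernel_form V K z \<le> kernel_form V K x"
    using continuous_attains_sup[OF compact_unit_sphere[OF finite_V], of "kernel_form V K"] by blast
  have "kernel_form V K y \<le> kernel_form V K x * inner_on V y y" for y
  proof (cases "\<exists>v\<in>V. y v \<noteq> 0")
    case True
    then have "kernel_form V K y / inner_on V y y \<le> kernel_form V K x"
      using maximum(2)[OF normalise_in_unit_sphere[OF finite_V True]]
      by (simp add: kernel_form_normalise)
    then show ?thesis
      using inner_on_self_pos[OF finite_V True] by (simp add: pos_divide_le_eq)
  next
    case False
    then have "inner_on V y y = 0" "kernel_form V K y = 0"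
      by (simp_all add: kernel_form_def inner_on_def)
    then show ?thesis
      by simp
  qed
  moreover have "inner_on V x x = 1"
    using maximum(1) by (simp add: unit_sphere_def)
  ultimately show ?thesis
    by blast
qed

lemma top_eigenvalue_eqI:
  assumes bound: "\<And>y. kernel_form V K y \<le> \<rho> * inner_on V y y"
    and attained: "kernel_form V K x = \<rho> * inner_on V x x" and nonzero: "\<exists>v\<in>V. x v \<noteq> 0"
  shows "top_eigenvalue V K = \<rho>"
  unfolding top_eigenvalue_def
proof (rule Max_eqI)
  show "finite {k. kernel_eigenvalue V K k}"
    by (rule finite_kernel_eigenvalues[OF finite_V])
  show "\<rho> \<in> {k. kernel_eigenvalue V K k}"
    using nonzero rayleigh_maximiser_eigenvector[OF bound attained]
    by (auto simp: kernel_eigenvalue_def)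
  fix k assume "k \<in> {k. kernel_eigenvalue V K k}"
  then obtain y where eigenvector: "\<exists>v\<in>V. y v \<noteq> 0" "\<And>v. v \<in> V \<Longrightarrow> kernel_op V K y v = k * y v"
    by (auto simp: kernel_eigenvalue_def)
  have "k * inner_on V y y \<le> \<rho> * inner_on V y y"
    using bound[of y] kernel_form_eigenvector[of V K y k, OF eigenvector(2)] by simp
  then show "k \<le> \<rho>"
    using inner_on_self_pos[OF finite_V eigenvector(1)] by simp
qed

lemma kernel_form_le_top_eigenvalue: "kernel_form V K y \<le> top_eigenvalue V K * inner_on V y y"
  and ex_top_eigenvector: "\<exists>x. top_eigenvector V K x"
proof -
  obtain x where maximiser: "inner_on V x x = 1"
    "\<And>y. kernel_form V K y \<le> kernel_form V K x * inner_on V y y"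
    using ex_rayleigh_maximiser by blast
  have nonzero: "\<exists>v\<in>V. x v \<noteq> 0"
    using maximiser(1) inner_on_self_eq_0_iff[OF finite_V, of x] by auto
  have top: "top_eigenvalue V K = kernel_form V K x"
    by (rule top_eigenvalue_eqI[OF maximiser(2) _ nonzero]) (simp add: maximiser(1))
  then show "kernel_form V K y \<le> top_eigenvalue V K * inner_on V y y"
    by (simp add: maximiser(2))
  have "kernel_op V K x v = top_eigenvalue V K * x v" if "v \<in> V" for v
    unfolding top
    by (rule rayleigh_maximiser_eigenvector[OF maximiser(2) _ that]) (simp add: maximiser(1))
  then show "\<exists>x. top_eigenvector V K x"
    using nonzero unfolding top_eigenvector_def by blast
qed

lemma top_eigenvector_iff_maximal:
  "top_eigenvector V K x \<longleftrightarrow>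
     (\<exists>v\<in>V. x v \<noteq> 0) \<and> top_eigenvalue V K * inner_on V x x \<le> kernel_form V K x"
proof
  assume "top_eigenvector V K x"
  then show "(\<exists>v\<in>V. x v \<noteq> 0) \<and> top_eigenvalue V K * inner_on V x x \<le> kernel_form V K x"
    using kernel_form_eigenvector[of V K x "top_eigenvalue V K"] by (simp add: top_eigenvector_def)
next
  assume maximal: "(\<exists>v\<in>V. x v \<noteq> 0) \<and> top_eigenvalue V K * inner_on V x x \<le> kernel_form V K x"
  then have "kernel_form V K x = top_eigenvalue V K * inner_on V x x"
    using kernel_form_le_top_eigenvalue[of x] by simp
  then show "top_eigenvector V K x"
    using maximal rayleigh_maximiser_eigenvector[OF kernel_form_le_top_eigenvalue]
    by (simp add: top_eigenvector_def)
qed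

lemma top_eigenvector_abs:
  assumes off_diagonal: "\<And>u v. u \<in> V \<Longrightarrow> v \<in> V \<Longrightarrow> u \<noteq> v \<Longrightarrow> 0 \<le> K u v"
    and top: "top_eigenvector V K x"
  shows "top_eigenvector V K (\<lambda>v. \<bar>x v\<bar>)"
proof -
  have "kernel_form V K x \<le> kernel_form V K (\<lambda>v. \<bar>x v\<bar>)"
    unfolding kernel_form_eq_sum
  proof (intro sum_mono)
    fix u v assume "u \<in> V" "v \<in> V"
    then show "K u v * x u * x v \<le> K u v * \<bar>x u\<bar> * \<bar>x v\<bar>"
      using off_diagonal[of u v] mult_left_mono[of "x u * x v" "\<bar>x u\<bar> * \<bar>x v\<bar>" "K u v"]
      by (cases "u = v") (simp_all add: abs_mult[symmetric] mult.assoc)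
  qed
  then show ?thesis
    using top by (simp add: top_eigenvector_iff_maximal inner_on_def)
qed

lemma nonneg_top_eigenvector_pos:
  assumes off_diagonal: "\<And>u v. u \<in> V \<Longrightarrow> v \<in> V \<Longrightarrow> u \<noteq> v \<Longrightarrow> 0 \<le> K u v"
    and irreducible: "\<And>u v. u \<in> V \<Longrightarrow> v \<in> V \<Longrightarrow> (u, v) \<in> {(a, b) \<in> V \<times> V. 0 < K a b}\<^sup>*"
    and top: "top_eigenvector V K x" and nonneg: "\<And>v. v \<in> V \<Longrightarrow> 0 \<le> x v" and "v \<in> V"
  shows "0 < x v"
proof -
  have zero_spreads: "x w = 0"
    if arc: "(u, w) \<in> {(a, b) \<in> V \<times> V. 0 < K a b}" and zero: "x u = 0" for u w
  proof -
    have "(\<Sum>w\<in>V. K u w * x w) = 0"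
      using top arc zero by (simp add: top_eigenvector_def kernel_op_def)
    moreover have "0 \<le> K u w * x w" if "w \<in> V" for w
      using off_diagonal[of u w] nonneg arc zero that by (cases "u = w") simp_all
    ultimately have "\<forall>w\<in>V. K u w * x w = 0"
      using finite_V by (subst (asm) sum_nonneg_eq_0_iff) auto
    then show ?thesis
      using arc by auto
  qed
  have "x v \<noteq> 0"
  proof
    assume "x v = 0"
    have "x w = 0" if "w \<in> V" for w
      using irreducible[OF \<open>v \<in> V\<close> that]
      by (induction rule: rtrancl_induct) (use \<open>x v = 0\<close> zero_spreads in auto)
    then show False
      using top by (simp add: top_eigenvector_def)
  qed
  then show ?thesis
    using nonneg[OF \<open>v \<in> V\<close>] by simp
qed

lemma ex_positive_top_eigenvector:
  assumes off_diagonal: "\<And>u v. u \<in> V \<Longrightarrow> v \<in> V \<Longrightarrow> u \<noteq> v \<Longrightarrow> 0 \<le> K u v"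
    and irreducible: "\<And>u v. u \<in> V \<Longrightarrow> v \<in> V \<Longrightarrow> (u, v) \<in> {(a, b) \<in> V \<times> V. 0 < K a b}\<^sup>*"
  shows "\<exists>x. top_eigenvector V K x \<and> (\<forall>v\<in>V. 0 < x v)"
proof -
  obtain x where "top_eigenvector V K x"
    using ex_top_eigenvector ..
  then have "top_eigenvector V K (\<lambda>v. \<bar>x v\<bar>)"
    by (intro top_eigenvector_abs off_diagonal)
  moreover from this have "0 < \<bar>x v\<bar>" if "v \<in> V" for v
    using that by (intro nonneg_top_eigenvector_pos off_diagonal irreducible) auto
  ultimately show ?thesis
    by blast
qed

end

lemma top_eigenvalue_le:
  assumes symmetric_W: "symmetric_kernel W L" and bij: "bij_betw f W V"
    and top: "top_eigenvector V K x" and forms: "kernel_form V K x \<le> kernel_form W L (x \<circ> f)"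
  shows "top_eigenvalue V K \<le> top_eigenvalue W L"
    and "top_eigenvalue V K = top_eigenvalue W L \<Longrightarrow> top_eigenvector W L (x \<circ> f)"
proof -
  have form_eq: "kernel_form V K x = top_eigenvalue V K * inner_on W (x \<circ> f) (x \<circ> f)"
    using top kernel_form_eigenvector[of V K x] inner_on_reindex[OF bij, of x x]
    by (simp add: top_eigenvector_def)
  have nonzero: "\<exists>w\<in>W. (x \<circ> f) w \<noteq> 0"
    using top bij by (auto simp: top_eigenvector_def bij_betw_def)
  have "top_eigenvalue V K * inner_on W (x \<circ> f) (x \<circ> f) \<le>
      top_eigenvalue W L * inner_on W (x \<circ> f) (x \<circ> f)"
    using forms form_eq symmetric_kernel.kernel_form_le_top_eigenvalue[OF symmetric_W, of "x \<circ> f"]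
    by simp
  then show "top_eigenvalue V K \<le> top_eigenvalue W L"
    using inner_on_self_pos[OF symmetric_kernel.finite_V[OF symmetric_W] nonzero] by simp
  assume "top_eigenvalue V K = top_eigenvalue W L"
  then show "top_eigenvector W L (x \<circ> f)"
    using forms form_eq nonzero
    by (simp add: symmetric_kernel.top_eigenvector_iff_maximal[OF symmetric_W])
qed

section \<open>The matrices $A_\alpha$\<close>

definition alpha_kernel :: "real \<Rightarrow> 'a pair_pre_digraph \<Rightarrow> 'a \<Rightarrow> 'a \<Rightarrow> real" where
  "alpha_kernel \<alpha> G u v =
     (if u = v then \<alpha> * real (out_degree (with_proj G) u) else 0) +
     (if (u, v) \<in> parcs G then 1 - \<alpha> else 0)"

abbreviation alpha_op :: "real \<Rightarrow> 'a pair_pre_digraph \<Rightarrow> ('a \<Rightarrow> real) \<Rightarrow> 'a \<Rightarrow> real" where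
  "alpha_op \<alpha> G \<equiv> kernel_op (pverts G) (alpha_kernel \<alpha> G)"

abbreviation alpha_form :: "real \<Rightarrow> 'a pair_pre_digraph \<Rightarrow> ('a \<Rightarrow> real) \<Rightarrow> real" where
  "alpha_form \<alpha> G \<equiv> kernel_form (pverts G) (alpha_kernel \<alpha> G)"

lemma bij_betw_vertex_list:
  assumes "finite (pverts G)"
  shows "bij_betw ((!) (vertex_list G)) {..<card (pverts G)} (pverts G)"
proof -
  have "distinct (vertex_list G) \<and> set (vertex_list G) = pverts G"
    unfolding vertex_list_def using finite_distinct_list[OF assms]
    by (metis (mono_tags, lifting) someI_ex)
  then show ?thesis
    by (metis bij_betw_nth distinct_card)
qed

lemma A_alpha_eq_mat:
  assumes "finite (pverts G)"
  shows "A_alpha \<alpha> G = Matrix.mat (card (pverts G)) (card (pverts G))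
    (\<lambda>(i, j). alpha_kernel \<alpha> G (vertex_list G ! i) (vertex_list G ! j))"
proof (rule eq_matI)
  fix i j
  let ?n = "card (pverts G)" and ?f = "(!) (vertex_list G)"
  assume "i < dim_row (Matrix.mat ?n ?n (\<lambda>(i, j). alpha_kernel \<alpha> G (?f i) (?f j)))"
    "j < dim_col (Matrix.mat ?n ?n (\<lambda>(i, j). alpha_kernel \<alpha> G (?f i) (?f j)))"
  moreover from this have "?f i = ?f j \<longleftrightarrow> i = j"
    using inj_on_eq_iff[OF bij_betw_imp_inj_on[OF bij_betw_vertex_list[OF assms]], of i j] by simp
  ultimately show "A_alpha \<alpha> G $$ (i, j) =
      Matrix.mat ?n ?n (\<lambda>(i, j). alpha_kernel \<alpha> G (?f i) (?f j)) $$ (i, j)"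
    by (simp add: A_alpha_def degree_matrix_def adjacency_matrix_def mat_diag_def Let_def
        alpha_kernel_def)
qed (simp_all add: A_alpha_def degree_matrix_def adjacency_matrix_def mat_diag_def Let_def)

lemma rho_eq_top_eigenvalue:
  assumes "finite (pverts G)"
  shows "rho \<alpha> G = top_eigenvalue (pverts G) (alpha_kernel \<alpha> G)"
  unfolding rho_def top_eigenvalue_def A_alpha_eq_mat[OF assms] eigenvalue_mat_iff
  by (simp add: kernel_eigenvalue_reindex[OF bij_betw_vertex_list[OF assms]])

context pair_graph
begin

lemma symmetric_kernel_alpha:
  assumes "pverts G \<noteq> {}"
  shows "symmetric_kernel (pverts G) (alpha_kernel \<alpha> G)"
  using assms pair_finite_verts arcs_symmetric by unfold_locales (auto simp: alpha_kernel_def)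

lemma finite_neighbours: "finite (parcs G `` {v})"
  using pair_finite_arcs by (rule finite_Image)

lemma out_degree_eq_card_neighbours: "out_degree (with_proj G) v = card (parcs G `` {v})"
proof -
  have "out_arcs (with_proj G) v = Pair v ` (parcs G `` {v})"
    by (auto simp: out_arcs_def)
  then show ?thesis
    by (simp add: out_degree_def card_image inj_on_def)
qed

lemma alpha_op_eq_sum:
  assumes "v \<in> pverts G"
  shows "alpha_op \<alpha> G x v = (\<Sum>w\<in>parcs G `` {v}. \<alpha> * x v + (1 - \<alpha>) * x w)"
proof -
  have "alpha_op \<alpha> G x v = (\<Sum>w\<in>pverts G. if v = w then \<alpha> * card (parcs G `` {v}) * x v else 0) +
      (\<Sum>w\<in>pverts G. if (v, w) \<in> parcs G then (1 - \<alpha>) * x w else 0)"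
    unfolding kernel_op_def alpha_kernel_def out_degree_eq_card_neighbours sum.distrib[symmetric]
    by (intro sum.cong refl) (auto simp: algebra_simps)
  also have "(\<Sum>w\<in>pverts G. if v = w then \<alpha> * card (parcs G `` {v}) * x v else 0) =
      (\<Sum>w\<in>parcs G `` {v}. \<alpha> * x v)"
    using assms pair_finite_verts by simp
  also have "(\<Sum>w\<in>pverts G. if (v, w) \<in> parcs G then (1 - \<alpha>) * x w else 0) =
      (\<Sum>w\<in>parcs G `` {v}. (1 - \<alpha>) * x w)"
    using wellformed' pair_finite_verts by (intro sum.mono_neutral_cong_right) auto
  finally show ?thesis
    by (simp add: sum.distrib)
qed

lemma alpha_form_eq_sum:
  "alpha_form \<alpha> G x = (\<Sum>(u, v)\<in>parcs G. \<alpha> * (x u)\<^sup>2 + (1 - \<alpha>) * x u * x v)"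
proof -
  have "alpha_form \<alpha> G x = (\<Sum>u\<in>pverts G. \<Sum>v\<in>parcs G `` {u}. \<alpha> * (x u)\<^sup>2 + (1 - \<alpha>) * x u * x v)"
    unfolding kernel_form_def inner_on_def
    by (intro sum.cong refl) (simp add: alpha_op_eq_sum sum_distrib_left algebra_simps power2_eq_square)
  also have "\<dots> = (\<Sum>(u, v)\<in>Sigma (pverts G) (\<lambda>u. parcs G `` {u}). \<alpha> * (x u)\<^sup>2 + (1 - \<alpha>) * x u * x v)"
    by (rule sum.Sigma) (simp_all add: pair_finite_verts finite_neighbours)
  also have "Sigma (pverts G) (\<lambda>u. parcs G `` {u}) = parcs G"
    using wellformed' by auto
  finally show ?thesis .
qed

end

definition perron_vector :: "real \<Rightarrow> 'a pair_pre_digraph \<Rightarrow> ('a \<Rightarrow> real) \<Rightarrow> bool" where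
  "perron_vector \<alpha> G x \<longleftrightarrow>
     top_eigenvector (pverts G) (alpha_kernel \<alpha> G) x \<and> (\<forall>v\<in>pverts G. 0 < x v)"

lemma (in pair_graph) ex_perron_vector:
  assumes "0 \<le> \<alpha>" "\<alpha> < 1" "pverts G \<noteq> {}"
    and connected: "\<And>u v. u \<in> pverts G \<Longrightarrow> v \<in> pverts G \<Longrightarrow> (u, v) \<in> (parcs G)\<^sup>*"
  shows "\<exists>x. perron_vector \<alpha> G x"
proof -
  interpret kernel: symmetric_kernel "pverts G" "alpha_kernel \<alpha> G"
    by (rule symmetric_kernel_alpha[OF assms(3)])
  have "parcs G \<subseteq> {(u, v) \<in> pverts G \<times> pverts G. 0 < alpha_kernel \<alpha> G u v}"
    using assms wellformed' by (auto simp: alpha_kernel_def intro: add_nonneg_pos)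
  then have "(parcs G)\<^sup>* \<subseteq> {(u, v) \<in> pverts G \<times> pverts G. 0 < alpha_kernel \<alpha> G u v}\<^sup>*"
    by (rule rtrancl_mono)
  moreover have "0 \<le> alpha_kernel \<alpha> G u v" for u v
    using assms by (simp add: alpha_kernel_def)
  ultimately show ?thesis
    unfolding perron_vector_def by (intro kernel.ex_positive_top_eigenvector) (use connected in blast)+
qed

lemma rho_le_of_alpha_form_le:
  assumes graphs: "pair_graph G" "pair_graph H" and perron: "perron_vector \<alpha> G x"
    and bij: "bij_betw f (pverts H) (pverts G)"
    and forms: "alpha_form \<alpha> G x \<le> alpha_form \<alpha> H (x \<circ> f)"
  shows "rho \<alpha> G \<le> rho \<alpha> H"
    and "rho \<alpha> G = rho \<alpha> H \<Longrightarrow> v \<in> pverts H \<Longrightarrow> alpha_op \<alpha> H (x \<circ> f) v = alpha_op \<alpha> G x (f v)"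
proof -
  interpret G: pair_graph G
    by (rule graphs)
  interpret H: pair_graph H
    by (rule graphs)
  have top: "top_eigenvector (pverts G) (alpha_kernel \<alpha> G) x"
    using perron by (simp add: perron_vector_def)
  then have "pverts H \<noteq> {}"
    using bij by (auto simp: top_eigenvector_def bij_betw_def)
  then have symmetric_H: "symmetric_kernel (pverts H) (alpha_kernel \<alpha> H)"
    by (rule H.symmetric_kernel_alpha)
  note rho_eq = rho_eq_top_eigenvalue[OF G.pair_finite_verts]
    rho_eq_top_eigenvalue[OF H.pair_finite_verts]
  show "rho \<alpha> G \<le> rho \<alpha> H"
    unfolding rho_eq by (rule top_eigenvalue_le(1)[OF symmetric_H bij top forms])
  assume equal: "rho \<alpha> G = rho \<alpha> H" and vertex: "v \<in> pverts H"
  then have "top_eigenvector (pverts H) (alpha_kernel \<alpha> H) (x \<circ> f)"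
    unfolding rho_eq by (intro top_eigenvalue_le(2)[OF symmetric_H bij top forms])
  then show "alpha_op \<alpha> H (x \<circ> f) v = alpha_op \<alpha> G x (f v)"
    using top equal vertex bij_betw_apply[OF bij vertex] by (simp add: top_eigenvector_def rho_eq)
qed

section \<open>Isomorphisms\<close>

definition graph_iso :: "('a \<Rightarrow> 'b) \<Rightarrow> 'a pair_pre_digraph \<Rightarrow> 'b pair_pre_digraph \<Rightarrow> bool" where
  "graph_iso f G H \<longleftrightarrow> bij_betw f (pverts G) (pverts H) \<and>
     (\<forall>u\<in>pverts G. \<forall>v\<in>pverts G. (f u, f v) \<in> parcs H \<longleftrightarrow> (u, v) \<in> parcs G)"

lemma (in pair_wf_digraph) parcs_subset: "parcs G \<subseteq> pverts G \<times> pverts G"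
  by (auto dest: wellformed')

lemma parcs_graph_iso:
  assumes "graph_iso f G H" "pair_wf_digraph G" "pair_wf_digraph H"
  shows "parcs H = map_prod f f ` parcs G"
proof -
  interpret G: pair_wf_digraph G by fact
  interpret H: pair_wf_digraph H by fact
  have verts: "pverts H = f ` pverts G"
    using assms(1) by (simp add: graph_iso_def bij_betw_def)
  show ?thesis
  proof (intro equalityI subrelI)
    fix a b assume arc: "(a, b) \<in> parcs H"
    then obtain u v where "u \<in> pverts G" "v \<in> pverts G" "a = f u" "b = f v"
      using H.wellformed'[OF arc] unfolding verts by auto
    with arc assms(1) show "(a, b) \<in> map_prod f f ` parcs G"
      by (auto simp: graph_iso_def)
  next
    fix a b assume "(a, b) \<in> map_prod f f ` parcs G"
    with assms(1) show "(a, b) \<in> parcs H"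
      by (auto simp: graph_iso_def dest: G.wellformed')
  qed
qed

lemma graph_iso_imp_digraph_iso:
  assumes iso: "graph_iso f G H" and wf: "pair_wf_digraph G" "pair_wf_digraph H"
  shows "digraph_iso (with_proj G) (with_proj H)"
proof -
  interpret G: pair_wf_digraph G by fact
  define h where "h = \<lparr>iso_verts = f, iso_arcs = map_prod f f, iso_head = snd, iso_tail = fst\<rparr>"
  have inj: "inj_on f (pverts G)" and verts: "pverts H = f ` pverts G"
    using iso by (auto simp: graph_iso_def bij_betw_def)
  have "inj_on (map_prod f f) (parcs G)"
    by (rule inj_on_subset[OF map_prod_inj_on[OF inj inj] G.parcs_subset])
  then have "pre_digraph.digraph_isomorphism (with_proj G) h"
    using inj G.wf_digraph by (auto simp: pre_digraph.digraph_isomorphism_def h_def)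
  moreover have "with_proj H = app_iso h (with_proj G)"
    using parcs_graph_iso[OF assms] verts by (simp add: app_iso_def h_def with_proj_def)
  ultimately show ?thesis
    by (auto simp: digraph_iso_def)
qed

lemma digraph_iso_imp_graph_iso:
  assumes "digraph_iso (with_proj G) (with_proj H)"
  obtains f where "graph_iso f G H"
proof -
  obtain h where isomorphism: "pre_digraph.digraph_isomorphism (with_proj G) h"
    and H_eq: "with_proj H = app_iso h (with_proj G)"
    using assms by (auto simp: digraph_iso_def)
  let ?f = "iso_verts h"
  interpret G: pair_wf_digraph G
    using isomorphism by (simp add: pre_digraph.digraph_isomorphism_def wf_digraph_wp_iff)
  have verts: "pverts H = ?f ` pverts G"
    using arg_cong[OF H_eq, of verts] by simp
  have arcs: "parcs H = map_prod ?f ?f ` parcs G"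
    using arg_cong[OF H_eq, of arcs_ends] G.arcs_ends_app_iso_eq[OF isomorphism]
    by (simp add: map_prod_def)
  have inj: "inj_on ?f (pverts G)"
    using isomorphism by (simp add: pre_digraph.digraph_isomorphism_def)
  have "(?f u, ?f v) \<in> parcs H \<longleftrightarrow> (u, v) \<in> parcs G" if "u \<in> pverts G" "v \<in> pverts G" for u v
    unfolding arcs
    using inj_on_image_mem_iff[OF map_prod_inj_on[OF inj inj] _ G.parcs_subset, of "(u, v)"] that
    by simp
  then show thesis
    using inj verts by (intro that[of ?f]) (simp add: graph_iso_def bij_betw_def)
qed

lemma alpha_kernel_graph_iso:
  assumes iso: "graph_iso f G H" and graphs: "pair_graph G" "pair_graph H"
    and vertices: "u \<in> pverts G" "v \<in> pverts G"
  shows "alpha_kernel \<alpha> H (f u) (f v) = alpha_kernel \<alpha> G u v"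
proof -
  interpret G: pair_graph G by fact
  interpret H: pair_graph H by fact
  have inj: "inj_on f (pverts G)" and arc: "(f u, f v) \<in> parcs H \<longleftrightarrow> (u, v) \<in> parcs G"
    using iso vertices by (auto simp: graph_iso_def bij_betw_def)
  have "parcs H `` {f u} = f ` (parcs G `` {u})"
    unfolding parcs_graph_iso[OF iso G.pair_wf_digraph H.pair_wf_digraph]
    using inj vertices G.wellformed' by (auto dest: inj_onD)
  moreover have "inj_on f (parcs G `` {u})"
    using G.wellformed' by (intro inj_on_subset[OF inj]) auto
  ultimately have "out_degree (with_proj H) (f u) = out_degree (with_proj G) u"
    by (simp add: G.out_degree_eq_card_neighbours H.out_degree_eq_card_neighbours card_image)
  then show ?thesis
    using arc inj vertices by (cases "u = v") (simp_all add: alpha_kernel_def inj_on_eq_iff)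
qed

lemma rho_digraph_iso:
  assumes "digraph_iso (with_proj G) (with_proj H)" and graphs: "pair_graph G" "pair_graph H"
  shows "rho \<alpha> G = rho \<alpha> H"
proof -
  interpret G: pair_graph G by fact
  interpret H: pair_graph H by fact
  obtain f where iso: "graph_iso f G H"
    using assms(1) by (rule digraph_iso_imp_graph_iso)
  then have "bij_betw f (pverts G) (pverts H)"
    by (simp add: graph_iso_def)
  then have "kernel_eigenvalue (pverts H) (alpha_kernel \<alpha> H) =
      kernel_eigenvalue (pverts G) (alpha_kernel \<alpha> G)"
    by (rule kernel_eigenvalue_reindex) (rule alpha_kernel_graph_iso[OF iso graphs])
  then show ?thesis
    by (simp add: rho_eq_top_eigenvalue G.pair_finite_verts H.pair_finite_verts top_eigenvalue_def)
qed

definition rho_dominated :: "real \<Rightarrow> 'a pair_pre_digraph \<Rightarrow> 'b pair_pre_digraph \<Rightarrow> bool" where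
  "rho_dominated \<alpha> G H \<longleftrightarrow> rho \<alpha> G \<le> rho \<alpha> H \<and>
     (rho \<alpha> G = rho \<alpha> H \<longrightarrow> digraph_iso (with_proj G) (with_proj H))"

lemma rho_dominated_trans:
  assumes "rho_dominated \<alpha> G H" "rho_dominated \<alpha> H K"
  shows "rho_dominated \<alpha> G K"
  using assms digraph_iso_trans[of "with_proj G" "with_proj H" "with_proj K"]
  by (auto simp: rho_dominated_def)

lemma rho_dominated_of_graph_iso:
  assumes iso: "graph_iso f G H" and graphs: "pair_graph G" "pair_graph H"
  shows "rho_dominated \<alpha> G H"
proof -
  interpret G: pair_graph G by fact
  interpret H: pair_graph H by fact
  have "digraph_iso (with_proj G) (with_proj H)"
    by (rule graph_iso_imp_digraph_iso[OF iso G.pair_wf_digraph H.pair_wf_digraph])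
  then show ?thesis
    using rho_digraph_iso[OF _ graphs] by (simp add: rho_dominated_def)
qed

section \<open>Parent maps\<close>

text \<open>Longer cycles of \<open>p\<close> are not excluded: it is enough that no edge is counted twice.\<close>

definition parent_map :: "'a pair_pre_digraph \<Rightarrow> 'a \<Rightarrow> ('a \<Rightarrow> 'a) \<Rightarrow> bool" where
  "parent_map G z p \<longleftrightarrow> z \<in> pverts G \<and> p ` (pverts G - {z}) \<subseteq> pverts G \<and>
     (\<forall>w\<in>pverts G - {z}. p w \<noteq> z \<longrightarrow> p (p w) \<noteq> w) \<and>
     (\<forall>u v. (u, v) \<in> parcs G \<longleftrightarrow> u \<in> pverts G - {z} \<and> v = p u \<or> v \<in> pverts G - {z} \<and> u = p v)"

definition edge_form :: "real \<Rightarrow> real \<Rightarrow> real \<Rightarrow> real" where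
  "edge_form \<alpha> a b = \<alpha> * (a\<^sup>2 + b\<^sup>2) + 2 * (1 - \<alpha>) * a * b"

lemma edge_form_commute: "edge_form \<alpha> a b = edge_form \<alpha> b a"
  by (simp add: edge_form_def algebra_simps)

lemma edge_form_mono:
  assumes "0 \<le> \<alpha>" "\<alpha> < 1" "0 < a" "0 < b" "b \<le> c"
  shows "edge_form \<alpha> a b \<le> edge_form \<alpha> a c"
  using assms unfolding edge_form_def
  by (intro add_mono mult_left_mono power_mono mult_nonneg_nonneg order_refl) auto

lemma parent_map_arc_iff:
  assumes "parent_map G z p"
  shows "(u, v) \<in> parcs G \<longleftrightarrow> u \<in> pverts G - {z} \<and> v = p u \<or> v \<in> pverts G - {z} \<and> u = p v"
  using assms by (simp add: parent_map_def)

lemma (in pair_graph) alpha_form_parent_map: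
  assumes parent: "parent_map G z p"
  shows "alpha_form \<alpha> G x = (\<Sum>w\<in>pverts G - {z}. edge_form \<alpha> (x w) (x (p w)))"
proof -
  let ?V = "pverts G - {z}"
  define to_parent where "to_parent w = (w, p w)" for w
  define from_parent where "from_parent w = (p w, w)" for w
  have arcs: "parcs G = to_parent ` ?V \<union> from_parent ` ?V"
    by (auto simp: parent_map_arc_iff[OF parent] to_parent_def from_parent_def)
  have disjoint: "to_parent ` ?V \<inter> from_parent ` ?V = {}"
    using parent by (auto simp: parent_map_def to_parent_def from_parent_def)
  have inj: "inj_on to_parent ?V" "inj_on from_parent ?V"
    by (auto simp: inj_on_def to_parent_def from_parent_def)
  have "alpha_form \<alpha> G x = (\<Sum>w\<in>?V. \<alpha> * (x w)\<^sup>2 + (1 - \<alpha>) * x w * x (p w)) +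
      (\<Sum>w\<in>?V. \<alpha> * (x (p w))\<^sup>2 + (1 - \<alpha>) * x (p w) * x w)"
    unfolding alpha_form_eq_sum arcs
    using disjoint pair_finite_verts
    by (simp add: sum.union_disjoint sum.reindex inj) (simp add: to_parent_def from_parent_def)
  also have "\<dots> = (\<Sum>w\<in>?V. edge_form \<alpha> (x w) (x (p w)))"
    unfolding sum.distrib[symmetric] by (intro sum.cong refl) (simp add: edge_form_def algebra_simps)
  finally show ?thesis .
qed

lemma graph_iso_parent_map:
  assumes parent_G: "parent_map G z p" and parent_H: "parent_map H c q"
    and bij: "bij_betw f (pverts H) (pverts G)" and root: "f c = z"
    and parents: "\<And>w. w \<in> pverts H - {c} \<Longrightarrow> p (f w) = f (q w)"
  shows "graph_iso f H G"
proof -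
  have f_eq_iff: "f u = f v \<longleftrightarrow> u = v" if "u \<in> pverts H" "v \<in> pverts H" for u v
    using inj_on_eq_iff[OF bij_betw_imp_inj_on[OF bij]] that by blast
  have H_in: "c \<in> pverts H" "\<And>w. w \<in> pverts H - {c} \<Longrightarrow> q w \<in> pverts H"
    using parent_H by (auto simp: parent_map_def)
  have f_in: "f u \<in> pverts G" if "u \<in> pverts H" for u
    using bij that by (rule bij_betw_apply)
  have "f u \<in> pverts G - {z} \<and> f v = p (f u) \<longleftrightarrow> u \<in> pverts H - {c} \<and> v = q u"
    if "u \<in> pverts H" "v \<in> pverts H" for u v
    using that H_in f_in f_eq_iff[of u c] f_eq_iff[of v "q u"] parents[of u] root by auto
  then show ?thesis
    using bij
    unfolding graph_iso_def parent_map_arc_iff[OF parent_G] parent_map_arc_iff[OF parent_H]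
    by blast
qed

lemma neighbours_eq_of_alpha_op_eq:
  assumes alpha: "0 \<le> \<alpha>" "\<alpha> < 1" and graphs: "pair_graph G" "pair_graph H"
    and pos: "\<And>v. v \<in> pverts G \<Longrightarrow> 0 < x v"
    and bij: "bij_betw f (pverts H) (pverts G)" and vertex: "v \<in> pverts H"
    and subset: "parcs G `` {f v} \<subseteq> f ` (parcs H `` {v})"
    and op_eq: "alpha_op \<alpha> H (x \<circ> f) v = alpha_op \<alpha> G x (f v)"
  shows "parcs G `` {f v} = f ` (parcs H `` {v})"
proof (rule ccontr)
  interpret G: pair_graph G by fact
  interpret H: pair_graph H by fact
  define weight where "weight w = \<alpha> * x (f v) + (1 - \<alpha>) * x w" for w
  have neighbours_H: "parcs H `` {v} \<subseteq> pverts H"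
    using H.parcs_subset by auto
  then have inj: "inj_on f (parcs H `` {v})"
    using bij by (auto simp: bij_betw_def intro: inj_on_subset)
  have weight_pos: "0 < weight w" if "w \<in> f ` (parcs H `` {v})" for w
  proof -
    have "w \<in> pverts G"
      using that neighbours_H bij_betw_apply[OF bij] by auto
    then show ?thesis
      unfolding weight_def using alpha pos[OF bij_betw_apply[OF bij vertex]] pos[of w]
      by (intro add_nonneg_pos) auto
  qed
  assume "parcs G `` {f v} \<noteq> f ` (parcs H `` {v})"
  then obtain w where extra: "w \<in> f ` (parcs H `` {v}) - parcs G `` {f v}"
    using subset by blast
  have "sum weight (parcs G `` {f v}) < sum weight (f ` (parcs H `` {v}))"
    by (rule sum_strict_mono2[OF _ subset extra])
      (use extra weight_pos in \<open>auto simp: H.finite_neighbours intro: less_imp_le\<close>)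
  also have "\<dots> = alpha_op \<alpha> H (x \<circ> f) v"
    using vertex by (simp add: H.alpha_op_eq_sum sum.reindex[OF inj] weight_def)
  also have "\<dots> = sum weight (parcs G `` {f v})"
    unfolding op_eq weight_def by (rule G.alpha_op_eq_sum[OF bij_betw_apply[OF bij vertex]])
  finally show False
    by simp
qed

text \<open>\<open>H\<close> arises from \<open>G\<close> by hanging some vertices at the root instead of their parents.\<close>

locale parent_redirection =
  fixes G :: "'a pair_pre_digraph" and H :: "'b pair_pre_digraph" and \<alpha> :: real
    and x :: "'a \<Rightarrow> real" and z :: 'a and p :: "'a \<Rightarrow> 'a" and c :: 'b and q :: "'b \<Rightarrow> 'b"
    and f :: "'b \<Rightarrow> 'a"
  assumes alpha: "0 \<le> \<alpha>" "\<alpha> < 1"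
    and graphs: "pair_graph G" "pair_graph H"
    and perron: "perron_vector \<alpha> G x"
    and parent_G: "parent_map G z p" and parent_H: "parent_map H c q"
    and bij: "bij_betw f (pverts H) (pverts G)" and root: "f c = z"
    and redirect: "w \<in> pverts H - {c} \<Longrightarrow> p (f w) = f (q w) \<or> q w = c \<and> x (p (f w)) \<le> x z"
begin

lemma bij_nonroot: "bij_betw f (pverts H - {c}) (pverts G - {z})"
  using bij_betw_DiffI[OF bij, of "{c}" "{z}"] root parent_G parent_H by (simp add: parent_map_def)

lemma alpha_form_le: "alpha_form \<alpha> G x \<le> alpha_form \<alpha> H (x \<circ> f)"
proof -
  have "alpha_form \<alpha> G x = (\<Sum>w\<in>pverts G - {z}. edge_form \<alpha> (x w) (x (p w)))"
    by (rule pair_graph.alpha_form_parent_map[OF graphs(1) parent_G])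
  also have "\<dots> = (\<Sum>w\<in>pverts H - {c}. edge_form \<alpha> (x (f w)) (x (p (f w))))"
    by (rule sum.reindex_bij_betw[OF bij_nonroot, symmetric])
  also have "\<dots> \<le> (\<Sum>w\<in>pverts H - {c}. edge_form \<alpha> (x (f w)) (x (f (q w))))"
  proof (rule sum_mono)
    fix w assume nonroot: "w \<in> pverts H - {c}"
    then have "f w \<in> pverts G - {z}"
      by (rule bij_betw_apply[OF bij_nonroot])
    then have "0 < x (f w)" "0 < x (p (f w))"
      using parent_G perron by (auto simp: parent_map_def perron_vector_def)
    then show "edge_form \<alpha> (x (f w)) (x (p (f w))) \<le> edge_form \<alpha> (x (f w)) (x (f (q w)))"
      using redirect[OF nonroot] alpha root by (auto intro: edge_form_mono)
  qed
  also have "\<dots> = alpha_form \<alpha> H (x \<circ> f)"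
    using pair_graph.alpha_form_parent_map[OF graphs(2) parent_H] by simp
  finally show ?thesis .
qed

lemma rho_le: "rho \<alpha> G \<le> rho \<alpha> H"
  by (rule rho_le_of_alpha_form_le(1)[OF graphs perron bij alpha_form_le])

lemma root_neighbours_subset: "parcs G `` {f c} \<subseteq> f ` (parcs H `` {c})"
proof
  fix u assume "u \<in> parcs G `` {f c}"
  then have "u \<in> pverts G - {z}" "p u = z"
    using root parent_map_arc_iff[OF parent_G] by auto
  then obtain w where child: "w \<in> pverts H - {c}" "u = f w" "p (f w) = f c"
    using bij_nonroot root by (auto simp: bij_betw_def image_iff)
  have "q w = c"
  proof (rule ccontr)
    assume "q w \<noteq> c"
    then have "f (q w) = f c"
      using redirect[OF child(1)] child(3) by simp
    moreover have "q w \<in> pverts H" "c \<in> pverts H"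
      using child(1) parent_H by (auto simp: parent_map_def)
    ultimately show False
      using \<open>q w \<noteq> c\<close> inj_on_eq_iff[OF bij_betw_imp_inj_on[OF bij]] by blast
  qed
  then show "u \<in> f ` (parcs H `` {c})"
    using child by (auto simp: parent_map_arc_iff[OF parent_H])
qed

lemma graph_iso_if_rho_eq:
  assumes "rho \<alpha> G = rho \<alpha> H"
  shows "graph_iso f H G"
proof (rule graph_iso_parent_map[OF parent_G parent_H bij root])
  have root_H: "c \<in> pverts H"
    using parent_H by (simp add: parent_map_def)
  have "alpha_op \<alpha> H (x \<circ> f) c = alpha_op \<alpha> G x (f c)"
    by (rule rho_le_of_alpha_form_le(2)[OF graphs perron bij alpha_form_le assms root_H])
  then have neighbours: "parcs G `` {f c} = f ` (parcs H `` {c})"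
    using perron
    by (intro neighbours_eq_of_alpha_op_eq[OF alpha graphs _ bij root_H root_neighbours_subset])
      (simp_all add: perron_vector_def)
  fix w assume nonroot: "w \<in> pverts H - {c}"
  show "p (f w) = f (q w)"
  proof (cases "q w = c")
    case True
    then have "f w \<in> parcs G `` {f c}"
      unfolding neighbours using nonroot by (auto simp: parent_map_arc_iff[OF parent_H])
    then show ?thesis
      using True root by (auto simp: parent_map_arc_iff[OF parent_G])
  next
    case False
    then show ?thesis
      using redirect[OF nonroot] by simp
  qed
qed

lemma rho_dominated: "rho_dominated \<alpha> G H"
proof -
  interpret G: pair_graph G by (rule graphs)
  interpret H: pair_graph H by (rule graphs)
  have "digraph_iso (with_proj G) (with_proj H)" if "rho \<alpha> G = rho \<alpha> H"
    using graph_iso_imp_digraph_iso[OF graph_iso_if_rho_eq[OF that] H.pair_wf_digraph G.pair_wf_digraph]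
    by (rule digraph_iso_swap[OF H.wf_digraph])
  then show ?thesis
    by (simp add: rho_dominated_def rho_le)
qed

end

section \<open>Brooms\<close>

definition broom :: "nat \<Rightarrow> nat \<Rightarrow> nat \<Rightarrow> nat pair_pre_digraph" where
  "broom n d c = \<lparr> pverts = {0..<n},
     parcs = symcl ({(i, Suc i) |i. i < d} \<union> {(c, j) |j. d < j \<and> j < n}) \<rparr>"

definition broom_parent :: "nat \<Rightarrow> nat \<Rightarrow> nat \<Rightarrow> nat \<Rightarrow> nat" where
  "broom_parent d r c j = (if j < r then Suc j else if j \<le> d then j - 1 else c)"

lemma T_tree_eq_broom: "T_tree n d = broom n d (d div 2)"
  by (simp add: T_tree_def broom_def)

lemma pverts_broom [simp]: "pverts (broom n d c) = {0..<n}"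
  by (simp add: broom_def)

lemma broom_arc_iff: "(u, v) \<in> parcs (broom n d c) \<longleftrightarrow>
    v = Suc u \<and> u < d \<or> u = Suc v \<and> v < d \<or> u = c \<and> d < v \<and> v < n \<or> v = c \<and> d < u \<and> u < n"
  by (auto simp: broom_def symcl_def)

lemma pair_graph_broom:
  assumes "d < n" "c \<le> d"
  shows "pair_graph (broom n d c)"
proof -
  have subset: "parcs (broom n d c) \<subseteq> {0..<n} \<times> {0..<n}"
    using assms by (auto simp: broom_arc_iff)
  then have "finite (parcs (broom n d c))"
    by (rule finite_subset) auto
  with subset show ?thesis
    using assms by unfold_locales (auto simp: symmetric_def sym_def broom_arc_iff)
qed

lemma broom_connected:
  assumes "d < n" "c \<le> d" "u < n" "v < n"
  shows "(u, v) \<in> (parcs (broom n d c))\<^sup>*"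
proof -
  let ?E = "parcs (broom n d c)"
  have path: "(0, j) \<in> ?E\<^sup>*" if "j \<le> d" for j
    using that by (induction j) (auto simp: broom_arc_iff intro: rtrancl_into_rtrancl)
  have from_0: "(0, j) \<in> ?E\<^sup>*" if "j < n" for j
    using that path[OF assms(2)] path[of j]
    by (cases "j \<le> d") (auto simp: broom_arc_iff intro: rtrancl_into_rtrancl)
  have "sym (?E\<^sup>*)"
    by (rule sym_rtrancl) (auto simp: sym_def broom_arc_iff)
  then show ?thesis
    using from_0[OF assms(3)] from_0[OF assms(4)] by (meson symD rtrancl_trans)
qed

lemma ex_perron_vector_broom:
  assumes "0 \<le> \<alpha>" "\<alpha> < 1" "d < n" "c \<le> d"
  shows "\<exists>x. perron_vector \<alpha> (broom n d c) x"
  using assms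
  by (intro pair_graph.ex_perron_vector pair_graph_broom) (auto intro: broom_connected)

lemma parent_map_broom:
  assumes "d < n" "c \<le> d" "r \<le> d"
  shows "parent_map (broom n d c) r (broom_parent d r c)"
proof -
  have "(u, v) \<in> parcs (broom n d c) \<longleftrightarrow>
      u \<in> {0..<n} - {r} \<and> v = broom_parent d r c u \<or> v \<in> {0..<n} - {r} \<and> u = broom_parent d r c v" for u v
    unfolding broom_arc_iff broom_parent_def using assms by auto
  moreover have "r < n" "broom_parent d r c ` ({0..<n} - {r}) \<subseteq> {0..<n}"
    using assms by (auto simp: broom_parent_def)
  moreover have "broom_parent d r c (broom_parent d r c w) \<noteq> w"
    if "w \<noteq> r" "broom_parent d r c w \<noteq> r" for w
    using that assms by (auto simp: broom_parent_def split: if_splits)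
  ultimately show ?thesis
    by (simp add: parent_map_def)
qed

lemma alpha_form_broom:
  assumes "d < n" "c \<le> d"
  shows "alpha_form \<alpha> (broom n d c) y =
    (\<Sum>j<d. edge_form \<alpha> (y j) (y (Suc j))) + (\<Sum>j\<in>{d<..<n}. edge_form \<alpha> (y c) (y j))"
proof -
  have "alpha_form \<alpha> (broom n d c) y =
      (\<Sum>j\<in>{1..d} \<union> {d<..<n}. edge_form \<alpha> (y j) (y (broom_parent d 0 c j)))"
    unfolding pair_graph.alpha_form_parent_map[OF pair_graph_broom parent_map_broom, OF assms assms le0]
    using assms by (intro sum.cong) auto
  also have "\<dots> = (\<Sum>j\<in>{1..d}. edge_form \<alpha> (y j) (y (broom_parent d 0 c j))) +
      (\<Sum>j\<in>{d<..<n}. edge_form \<alpha> (y j) (y (broom_parent d 0 c j)))"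
    by (intro sum.union_disjoint) auto
  also have "(\<Sum>j\<in>{1..d}. edge_form \<alpha> (y j) (y (broom_parent d 0 c j))) =
      (\<Sum>j<d. edge_form \<alpha> (y j) (y (Suc j)))"
    unfolding One_nat_def sum.atLeast1_atMost_eq
    by (intro sum.cong refl) (simp add: broom_parent_def edge_form_commute)
  also have "(\<Sum>j\<in>{d<..<n}. edge_form \<alpha> (y j) (y (broom_parent d 0 c j))) =
      (\<Sum>j\<in>{d<..<n}. edge_form \<alpha> (y c) (y j))"
    by (intro sum.cong refl) (simp add: broom_parent_def edge_form_commute)
  finally show ?thesis .
qed

lemma graph_iso_broom_mirror:
  assumes "d < n" "c \<le> d"
  shows "graph_iso (\<lambda>j. if j \<le> d then d - j else j) (broom n d c) (broom n d (d - c))"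
    (is "graph_iso ?f _ _")
proof (rule graph_iso_parent_map[of _ "d - c" _ _ c])
  show "parent_map (broom n d (d - c)) (d - c) (broom_parent d (d - c) (d - c))"
    "parent_map (broom n d c) c (broom_parent d c c)"
    using assms by (auto intro: parent_map_broom)
  show "bij_betw ?f (pverts (broom n d c)) (pverts (broom n d (d - c)))"
    using assms by (intro bij_betw_byWitness[where f' = ?f]) auto
qed (use assms in \<open>auto simp: broom_parent_def\<close>)

lemma rho_broom_less_by_shift:
  assumes "0 \<le> \<alpha>" "\<alpha> < 1" and centres: "i \<le> d" "m \<le> d" "i \<noteq> m" and pendant: "Suc d < n"
    and "perron_vector \<alpha> (broom n d i) x" "x i \<le> x m"
  shows "rho \<alpha> (broom n d i) < rho \<alpha> (broom n d m)"
proof -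
  interpret parent_redirection "broom n d i" "broom n d m" \<alpha> x
    m "broom_parent d m i" m "broom_parent d m m" id
    by (rule parent_redirection.intro)
      (use assms in \<open>auto simp: broom_parent_def intro!: pair_graph_broom parent_map_broom\<close>)
  have "\<not> graph_iso id (broom n d m) (broom n d i)"
  proof
    assume "graph_iso id (broom n d m) (broom n d i)"
    then have "(m, Suc d) \<in> parcs (broom n d i) \<longleftrightarrow> (m, Suc d) \<in> parcs (broom n d m)"
      using centres pendant by (simp add: graph_iso_def)
    then show False
      using centres pendant by (auto simp: broom_arc_iff)
  qed
  then show ?thesis
    using rho_le graph_iso_if_rho_eq by fastforce
qed

definition reverse_segment :: "nat \<Rightarrow> nat \<Rightarrow> nat \<Rightarrow> nat" where
  "reverse_segment L R j = (if L \<le> j \<and> j \<le> R then L + R - j else j)"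

lemma bij_betw_reverse_segment:
  assumes "R < n"
  shows "bij_betw (reverse_segment L R) {0..<n} {0..<n}"
  by (rule bij_betw_byWitness[where f' = "reverse_segment L R"])
    (use assms in \<open>auto simp: reverse_segment_def\<close>)

lemma sum_inside_reverse_segment:
  fixes h :: "'a \<Rightarrow> 'a \<Rightarrow> real"
  assumes commute: "\<And>a b. h a b = h b a"
  shows "(\<Sum>j\<in>{L..<R}. h (x (reverse_segment L R j)) (x (reverse_segment L R (Suc j)))) =
    (\<Sum>j\<in>{L..<R}. h (x j) (x (Suc j)))"
proof (rule sum.reindex_bij_witness[of _ "\<lambda>j. L + R - Suc j" "\<lambda>j. L + R - Suc j"])
  fix j assume "j \<in> {L..<R}"
  then have "reverse_segment L R j = Suc (L + R - Suc j)" "reverse_segment L R (Suc j) = L + R - Suc j"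
    by (auto simp: reverse_segment_def)
  then show "h (x (L + R - Suc j)) (x (Suc (L + R - Suc j))) =
      h (x (reverse_segment L R j)) (x (reverse_segment L R (Suc j)))"
    by (simp add: commute)
qed auto

lemma sum_before_reverse_segment:
  fixes h :: "'a \<Rightarrow> 'a \<Rightarrow> real"
  assumes "L \<le> R"
  shows "(\<Sum>j<L. h (x (reverse_segment L R j)) (x (reverse_segment L R (Suc j)))) =
    (\<Sum>j<L. h (x j) (x (Suc j))) +
    (if L = 0 then 0 else h (x (L - 1)) (x R) - h (x (L - 1)) (x L))"
proof (cases L)
  case (Suc l)
  have "(\<Sum>j<l. h (x (reverse_segment L R j)) (x (reverse_segment L R (Suc j)))) =
      (\<Sum>j<l. h (x j) (x (Suc j)))"
    by (intro sum.cong) (auto simp: reverse_segment_def Suc)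
  moreover have "reverse_segment L R l = l" "reverse_segment L R (Suc l) = R"
    using assms by (auto simp: reverse_segment_def Suc)
  ultimately show ?thesis
    by (simp add: Suc)
qed simp

lemma sum_after_reverse_segment:
  fixes h :: "'a \<Rightarrow> 'a \<Rightarrow> real"
  assumes "L \<le> R" "R < d"
  shows "(\<Sum>j\<in>{R..<d}. h (x (reverse_segment L R j)) (x (reverse_segment L R (Suc j)))) =
    (\<Sum>j\<in>{R..<d}. h (x j) (x (Suc j))) + (h (x L) (x (Suc R)) - h (x R) (x (Suc R)))"
proof -
  have "(\<Sum>j\<in>{Suc R..<d}. h (x (reverse_segment L R j)) (x (reverse_segment L R (Suc j)))) =
      (\<Sum>j\<in>{Suc R..<d}. h (x j) (x (Suc j)))"
    by (intro sum.cong) (auto simp: reverse_segment_def)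
  moreover have "reverse_segment L R R = L" "reverse_segment L R (Suc R) = Suc R"
    using assms by (auto simp: reverse_segment_def)
  ultimately show ?thesis
    using assms by (simp add: sum.atLeast_Suc_lessThan)
qed

lemma sum_reverse_segment:
  fixes h :: "'a \<Rightarrow> 'a \<Rightarrow> real"
  assumes commute: "\<And>a b. h a b = h b a" and "L \<le> R" "R < d"
  shows "(\<Sum>j<d. h (x (reverse_segment L R j)) (x (reverse_segment L R (Suc j)))) =
    (\<Sum>j<d. h (x j) (x (Suc j))) + (h (x L) (x (Suc R)) - h (x R) (x (Suc R))) +
    (if L = 0 then 0 else h (x (L - 1)) (x R) - h (x (L - 1)) (x L))"
proof -
  have split: "sum g {..<d} = sum g {..<L} + sum g {L..<R} + sum g {R..<d}" for g :: "nat \<Rightarrow> real"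
    using assms sum.atLeastLessThan_concat[of 0 L d g] sum.atLeastLessThan_concat[of L R d g]
    by (simp add: lessThan_atLeast0)
  show ?thesis
    unfolding split sum_before_reverse_segment[OF assms(2)]
      sum_inside_reverse_segment[where h = h, OF commute] sum_after_reverse_segment[OF assms(2,3)]
    by simp
qed

lemma alpha_form_broom_reversal_le:
  assumes alpha: "0 \<le> \<alpha>" "\<alpha> < 1" and segment: "L \<le> m" "m \<le> R" "L + R = i + m" "R < d"
    and size: "d < n" and pos: "\<And>v. v < n \<Longrightarrow> 0 < x v"
    and gain: "x R < x L" "L = 0 \<or> x (L - 1) \<le> x (Suc R)"
  shows "alpha_form \<alpha> (broom n d i) x \<le> alpha_form \<alpha> (broom n d m) (x \<circ> reverse_segment L R)"
proof -
  let ?f = "reverse_segment L R" and ?h = "edge_form \<alpha>"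
  have centres: "i \<le> d" "m \<le> d"
    using segment by auto
  have "0 \<le> ?h (x L) (x (Suc R)) - ?h (x R) (x (Suc R)) +
    (if L = 0 then 0 else ?h (x (L - 1)) (x R) - ?h (x (L - 1)) (x L))"
  proof (cases "L = 0")
    case True
    have "?h (x (Suc R)) (x R) \<le> ?h (x (Suc R)) (x L)"
      using alpha pos gain segment size by (intro edge_form_mono) auto
    then show ?thesis
      using True by (simp add: edge_form_commute[of \<alpha> "x (Suc R)"])
  next
    case False
    then have "0 \<le> 2 * (1 - \<alpha>) * ((x L - x R) * (x (Suc R) - x (L - 1)))"
      using alpha gain by simp
    then show ?thesis
      using False by (simp add: edge_form_def algebra_simps)
  qed
  moreover have "?f m = i"
    using segment by (auto simp: reverse_segment_def)
  moreover have "(\<Sum>j\<in>{d<..<n}. ?h (x i) (x (?f j))) = (\<Sum>j\<in>{d<..<n}. ?h (x i) (x j))"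
    using segment by (intro sum.cong) (auto simp: reverse_segment_def)
  moreover note sum_reverse_segment[of ?h L R d x, OF edge_form_commute]
  ultimately show ?thesis
    unfolding alpha_form_broom[OF size centres(1)] alpha_form_broom[OF size centres(2)] comp_apply
    using segment by simp
qed

lemma alpha_op_broom_reversal_less:
  assumes "\<alpha> < 1" "i \<le> R" "m \<le> R" "R < d" "d < n" "x R < x L" "L \<le> R"
  shows "alpha_op \<alpha> (broom n d i) x (Suc R) <
    alpha_op \<alpha> (broom n d m) (x \<circ> reverse_segment L R) (Suc R)"
proof -
  let ?f = "reverse_segment L R"
  define N where "N = (if Suc R < d then {R, Suc (Suc R)} else {R})"
  have neighbours: "parcs (broom n d c) `` {Suc R} = N" if "c \<le> R" for c
    using that assms by (auto simp: broom_arc_iff N_def)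
  have f_simps: "?f R = L" "?f (Suc R) = Suc R" "?f (Suc (Suc R)) = Suc (Suc R)"
    using assms by (auto simp: reverse_segment_def)
  have "(\<Sum>w\<in>N. \<alpha> * x (Suc R) + (1 - \<alpha>) * x w) < (\<Sum>w\<in>N. \<alpha> * x (Suc R) + (1 - \<alpha>) * x (?f w))"
    using assms by (simp add: N_def f_simps)
  moreover have "alpha_op \<alpha> (broom n d c) y (Suc R) = (\<Sum>w\<in>N. \<alpha> * y (Suc R) + (1 - \<alpha>) * y w)"
    if "c \<le> R" for c y
    unfolding neighbours[OF that, symmetric]
    using that assms by (intro pair_graph.alpha_op_eq_sum pair_graph_broom) auto
  ultimately show ?thesis
    using assms by (simp add: f_simps)
qed

lemma rho_broom_less_by_reversal:
  assumes alpha: "0 \<le> \<alpha>" "\<alpha> < 1" and segment: "L \<le> m" "m \<le> R" "L + R = i + m" "R < d"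
    and size: "d < n" and perron: "perron_vector \<alpha> (broom n d i) x"
    and gain: "x R < x L" "L = 0 \<or> x (L - 1) \<le> x (Suc R)"
  shows "rho \<alpha> (broom n d i) < rho \<alpha> (broom n d m)"
proof -
  let ?G = "broom n d i" and ?H = "broom n d m" and ?f = "reverse_segment L R"
  have graphs: "pair_graph ?G" "pair_graph ?H"
    using segment size by (auto intro!: pair_graph_broom)
  have bij: "bij_betw ?f (pverts ?H) (pverts ?G)"
    using bij_betw_reverse_segment[of R n L] segment size by simp
  have form_le: "alpha_form \<alpha> ?G x \<le> alpha_form \<alpha> ?H (x \<circ> ?f)"
    using perron
    by (intro alpha_form_broom_reversal_le[OF alpha segment size _ gain]) (simp add: perron_vector_def)
  have "rho \<alpha> ?G \<noteq> rho \<alpha> ?H"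
  proof
    assume "rho \<alpha> ?G = rho \<alpha> ?H"
    then have "alpha_op \<alpha> ?H (x \<circ> ?f) (Suc R) = alpha_op \<alpha> ?G x (?f (Suc R))"
      using segment size by (intro rho_le_of_alpha_form_le(2)[OF graphs perron bij form_le]) auto
    moreover have "?f (Suc R) = Suc R"
      by (simp add: reverse_segment_def)
    moreover have "alpha_op \<alpha> ?G x (Suc R) < alpha_op \<alpha> ?H (x \<circ> ?f) (Suc R)"
      using alpha segment size gain by (intro alpha_op_broom_reversal_less) auto
    ultimately show False
      by simp
  qed
  then show ?thesis
    using rho_le_of_alpha_form_le(1)[OF graphs perron bij form_le] by simp
qed

lemma ex_reversal_radius:
  fixes x :: "nat \<Rightarrow> 'a::linorder"
  assumes "x m < x i"
  obtains t where "t \<le> i" "x (m + t) < x (i - t)" "t = i \<or> x (i - Suc t) \<le> x (m + Suc t)"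
proof -
  define stop where "stop t \<longleftrightarrow> t = i \<or> x (i - Suc t) \<le> x (m + Suc t)" for t
  define t where "t = (LEAST t. stop t)"
  have "stop i"
    by (simp add: stop_def)
  then have "stop t" "t \<le> i"
    unfolding t_def by (rule LeastI, rule Least_le)
  moreover have "x (m + t) < x (i - t)"
  proof (cases t)
    case (Suc s)
    then have "\<not> stop s"
      using not_less_Least[of s stop] by (simp add: t_def)
    then show ?thesis
      by (simp add: stop_def Suc not_le)
  qed (simp add: assms)
  ultimately show thesis
    using that by (auto simp: stop_def)
qed

lemma rho_broom_less:
  assumes alpha: "0 \<le> \<alpha>" "\<alpha> < 1" and "i < m" "2 * m \<le> d" "Suc d < n"
  shows "rho \<alpha> (broom n d i) < rho \<alpha> (broom n d m)"
proof -
  obtain x where perron: "perron_vector \<alpha> (broom n d i) x"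
    using ex_perron_vector_broom[OF alpha, of d n i] assms by auto
  show ?thesis
  proof (cases "x i \<le> x m")
    case True
    then show ?thesis
      using assms perron by (intro rho_broom_less_by_shift) auto
  next
    case False
    then have "x m < x i"
      by simp
    then obtain t where "t \<le> i" "x (m + t) < x (i - t)" "t = i \<or> x (i - Suc t) \<le> x (m + Suc t)"
      by (rule ex_reversal_radius)
    then show ?thesis
      using assms perron by (intro rho_broom_less_by_reversal[of \<alpha> "i - t" m "m + t" i]) auto
  qed
qed

lemma rho_dominated_broom_central:
  assumes alpha: "0 \<le> \<alpha>" "\<alpha> < 1" and size: "c \<le> d" "d < n"
  shows "rho_dominated \<alpha> (broom n d c) (broom n d (d div 2))"
proof -
  let ?m = "d div 2"
  have left_half: "rho_dominated \<alpha> (broom n d i) (broom n d ?m)" if "i \<le> ?m" for i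
  proof (cases "i = ?m \<or> n = Suc d")
    case True
    then have "graph_iso id (broom n d i) (broom n d ?m)"
      by (auto simp: graph_iso_def broom_arc_iff)
    then show ?thesis
      using that size by (intro rho_dominated_of_graph_iso) (auto intro: pair_graph_broom)
  next
    case False
    then have "rho \<alpha> (broom n d i) < rho \<alpha> (broom n d ?m)"
      using that size by (intro rho_broom_less[OF alpha]) auto
    then show ?thesis
      by (simp add: rho_dominated_def)
  qed
  show ?thesis
  proof (cases "c \<le> ?m")
    case False
    have "rho_dominated \<alpha> (broom n d c) (broom n d (d - c))"
      by (rule rho_dominated_of_graph_iso[OF graph_iso_broom_mirror])
        (use size in \<open>auto intro: pair_graph_broom\<close>)
    moreover have "d - c \<le> ?m"
      using False by simp
    ultimately show ?thesis
      using left_half rho_dominated_trans by blast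
  qed (rule left_half)
qed

section \<open>Trees\<close>

lemma (in wf_digraph) cycle_Cons_apath:
  assumes "apath u p v" "a \<in> arcs G" "tail G a = v" "head G a = u"
  shows "cycle (a # p)"
  using assms by (auto simp: cycle_def apath_def awalk_Cons_iff intro!: exI[of _ v])

lemma undirected_tree_reachable:
  assumes "undirected_tree T" "u \<in> pverts T" "v \<in> pverts T"
  shows "u \<rightarrow>\<^sup>*\<^bsub>with_proj T\<^esub> v"
proof -
  interpret pair_graph T
    using assms(1) by (simp add: undirected_tree_def)
  have "u \<rightarrow>\<^sup>*\<^bsub>with_proj (mk_symmetric (with_proj T))\<^esub> v"
    using assms by (simp add: undirected_tree_def Digraph_Component.connected_def strongly_connected_def)
  then show ?thesis
    using reachable_mk_symmetric_eq[OF pair_sym_arcs] by simp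
qed

text \<open>An arc of the tree joined by a path that avoids it would close a cycle.\<close>

lemma undirected_tree_arc_in_connecting_subset:
  assumes tree: "undirected_tree T" and subset: "F \<subseteq> parcs T"
    and arc: "(a, b) \<in> parcs T" and connected: "(a, b) \<in> F\<^sup>*"
  shows "(a, b) \<in> F"
proof -
  interpret pair_graph T
    using tree by (simp add: undirected_tree_def)
  define H where "H = \<lparr>pverts = pverts T, parcs = F\<rparr>"
  have F_verts: "F \<subseteq> pverts T \<times> pverts T"
    using subset parcs_subset by simp
  interpret H: pair_wf_digraph H
    using F_verts by unfold_locales (auto simp: H_def)
  have "a \<rightarrow>\<^sup>*\<^bsub>with_proj H\<^esub> b"
    unfolding reachable_def using connected wellformed'[OF arc] F_verts
    by (intro rtrancl_consistent_rtrancl_on) (auto simp: H_def)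
  then obtain p where "H.apath a p b"
    using H.reachable_apath by auto
  then have "set p \<subseteq> F" "apath a p b"
    using subset wellformed'[OF arc] unfolding H.apath_def H.awalk_def
    by (auto simp: apath_def awalk_def H_def)
  then have "cycle ((b, a) # p)"
    using arcs_symmetric[OF arc] by (intro cycle_Cons_apath) auto
  then have "length p < 2"
    using tree by (auto simp: undirected_tree_def not_le)
  then consider "p = []" | e where "p = [e]"
    by (cases p; cases "tl p") auto
  then show ?thesis
  proof cases
    case 1
    then show ?thesis
      using \<open>apath a p b\<close> no_loops'[OF arc] by (simp add: apath_Nil_iff)
  next
    case 2
    then show ?thesis
      using \<open>apath a p b\<close> \<open>set p \<subseteq> F\<close> by (auto simp: apath_def awalk_def prod_eq_iff)
  qed
qed

lemma ex_descending_neighbour: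
  assumes "\<And>w. w \<in> V \<Longrightarrow> (w, z) \<in> E\<^sup>*"
  obtains p and depth :: "'a \<Rightarrow> nat"
  where "\<And>w. w \<in> V \<Longrightarrow> w \<noteq> z \<Longrightarrow> (w, p w) \<in> E \<and> depth (p w) < depth w"
proof -
  define depth where "depth w = (LEAST k. (w, z) \<in> E ^^ k)" for w
  have "\<exists>u. (w, u) \<in> E \<and> depth u < depth w" if nonroot: "w \<in> V" "w \<noteq> z" for w
  proof -
    have "(w, z) \<in> E ^^ depth w"
      using rtrancl_imp_relpow[OF assms[OF nonroot(1)]] unfolding depth_def by (auto intro: LeastI)
    moreover from this obtain k where depth_eq: "depth w = Suc k"
      using nonroot(2) by (cases "depth w") auto
    ultimately obtain u where "(w, u) \<in> E" "(u, z) \<in> E ^^ k"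
      by (metis relpow_Suc_D2)
    moreover from this(2) have "depth u \<le> k"
      unfolding depth_def by (rule Least_le)
    ultimately show ?thesis
      using depth_eq by auto
  qed
  then show thesis
    using that by metis
qed

lemma rtrancl_descending:
  fixes depth :: "'a \<Rightarrow> nat"
  assumes "\<And>w. w \<in> V \<Longrightarrow> w \<noteq> z \<Longrightarrow> (w, p w) \<in> F \<and> p w \<in> V \<and> depth (p w) < depth w" and "w \<in> V"
  shows "(w, z) \<in> F\<^sup>*"
  using assms(2)
proof (induction "depth w" arbitrary: w rule: less_induct)
  case less
  then show ?case
    using assms(1)[OF less.prems] by (cases "w = z") (auto intro: converse_rtrancl_into_rtrancl)
qed

lemma undirected_tree_parent_map:
  assumes tree: "undirected_tree T" and root: "z \<in> pverts T"
  obtains p where "parent_map T z p"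
proof -
  interpret pair_graph T
    using tree by (simp add: undirected_tree_def)
  have "(w, z) \<in> (parcs T)\<^sup>*" if "w \<in> pverts T" for w
    using reachable_rtranclI[OF undirected_tree_reachable[OF tree that root]] by simp
  then obtain p and depth :: "'a \<Rightarrow> nat"
    where descends: "\<And>w. w \<in> pverts T \<Longrightarrow> w \<noteq> z \<Longrightarrow> (w, p w) \<in> parcs T \<and> depth (p w) < depth w"
    using ex_descending_neighbour by metis
  then have p_in: "p w \<in> pverts T" if "w \<in> pverts T" "w \<noteq> z" for w
    using that wellformed' by blast
  define F where "F = symcl ((\<lambda>w. (w, p w)) ` (pverts T - {z}))"
  have F_iff: "(u, v) \<in> F \<longleftrightarrow> u \<in> pverts T - {z} \<and> v = p u \<or> v \<in> pverts T - {z} \<and> u = p v" for u v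
    by (auto simp: F_def symcl_def)
  have F_subset: "F \<subseteq> parcs T"
    using descends arcs_symmetric by (auto simp: F_iff)
  have to_z: "(w, z) \<in> F\<^sup>*" if "w \<in> pverts T" for w
    using that descends p_in by (intro rtrancl_descending[of "pverts T" z p F depth]) (auto simp: F_iff)
  have "sym (F\<^sup>*)"
    by (rule sym_rtrancl) (auto simp: F_iff sym_def)
  then have "(a, b) \<in> F\<^sup>*" if "a \<in> pverts T" "b \<in> pverts T" for a b
    using to_z[OF that(1)] to_z[OF that(2)] by (meson symD rtrancl_trans)
  then have "parcs T \<subseteq> F"
    using undirected_tree_arc_in_connecting_subset[OF tree F_subset] wellformed' by auto
  with F_subset have "(u, v) \<in> parcs T \<longleftrightarrow>
      u \<in> pverts T - {z} \<and> v = p u \<or> v \<in> pverts T - {z} \<and> u = p v" for u v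
    unfolding F_iff[symmetric] by blast
  moreover have "p (p w) \<noteq> w" if "w \<in> pverts T - {z}" "p w \<noteq> z" for w
    using descends[of w] descends[of "p w"] that p_in[of w] by auto
  ultimately show thesis
    using root p_in by (intro that[of p]) (auto simp: parent_map_def)
qed

definition path_in :: "'a pair_pre_digraph \<Rightarrow> nat \<Rightarrow> (nat \<Rightarrow> 'a) \<Rightarrow> bool" where
  "path_in G d v \<longleftrightarrow> inj_on v {..d} \<and> v ` {..d} \<subseteq> pverts G \<and> (\<forall>j<d. (v j, v (Suc j)) \<in> parcs G)"

lemma nth_pawalk_verts_arc:
  assumes "pcas u p v" "j < length p"
  shows "(pawalk_verts u p ! j, pawalk_verts u p ! Suc j) = p ! j"
  using assms
proof (induction p arbitrary: u j)
  case (Cons e p)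
  then show ?case
    by (cases j; cases p) (auto simp: prod_eq_iff)
qed simp

lemma (in pair_wf_digraph) path_in_of_apath:
  assumes path: "apath u p w" and "d \<le> length p"
  shows "path_in G d ((!) (pawalk_verts u p))"
proof -
  have walk: "pcas u p w" "distinct (pawalk_verts u p)" "set p \<subseteq> parcs G"
    using path by (auto simp: apath_def awalk_def)
  have "set (pawalk_verts u p) \<subseteq> pverts G"
    using path by (auto simp: apath_def)
  moreover have "length (pawalk_verts u p) = Suc (length p)"
    by (rule length_awalk_verts)
  ultimately have "inj_on ((!) (pawalk_verts u p)) {..d}" "(!) (pawalk_verts u p) ` {..d} \<subseteq> pverts G"
    using walk(2) assms(2) by (auto simp: inj_on_def nth_eq_iff_index_eq subset_iff)
  moreover have "(pawalk_verts u p ! j, pawalk_verts u p ! Suc j) \<in> parcs G" if "j < d" for j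
    using nth_pawalk_verts_arc[OF walk(1), of j] walk(3) that assms(2) by auto
  ultimately show ?thesis
    by (simp add: path_in_def)
qed

lemma (in pair_fin_digraph) ex_apath_of_diameter:
  assumes reachable: "\<And>u v. u \<in> pverts G \<Longrightarrow> v \<in> pverts G \<Longrightarrow> u \<rightarrow>\<^sup>*\<^bsub>with_proj G\<^esub> v"
    and diameter: "graph_diameter G = ereal (real d)"
  shows "\<exists>u p v. apath u p v \<and> d \<le> length p"
proof (rule ccontr)
  assume "\<not> ?thesis"
  then have short: "length p < d" if "apath u p v" for u p v
    using that by (auto simp: not_le)
  have "\<mu> (\<lambda>_. 1) u v \<le> ereal (real d - 1)" if vertices: "u \<in> pverts G" "v \<in> pverts G" for u v
  proof -
    have "awalk_cost (\<lambda>_. 1) p = real (length p)" for p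
      by (simp add: awalk_cost_def sum_list_triv)
    then obtain p where "apath u p v" "\<mu> (\<lambda>_. 1) u v = ereal (real (length p))"
      using min_cost_awalk[OF reachable[OF vertices], of "\<lambda>_. 1"] by auto
    then show ?thesis
      using short[of u p v] by simp
  qed
  then have "graph_diameter G \<le> ereal (real d - 1)"
    unfolding graph_diameter_def by (intro SUP_least) auto
  then show False
    using diameter by simp
qed

lemma undirected_tree_path_of_diameter:
  assumes tree: "undirected_tree T" and diameter: "graph_diameter T = ereal (real d)"
  obtains v where "path_in T d v"
proof -
  interpret pair_graph T
    using tree by (simp add: undirected_tree_def)
  obtain u p w where "apath u p w" "d \<le> length p"
    using ex_apath_of_diameter[OF undirected_tree_reachable[OF tree] diameter] by blast
  then show thesis
    by (rule that[OF path_in_of_apath])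
qed

lemma (in pair_fin_digraph) path_in_length_less:
  assumes "path_in G d v"
  shows "d < card (pverts G)"
proof -
  have "card {..d} \<le> card (pverts G)"
    using assms pair_finite_verts by (intro card_inj_on_le[of v]) (auto simp: path_in_def)
  then show ?thesis
    by simp
qed

lemma bij_betw_extend:
  assumes sets: "finite A" "finite B" "card A = card B"
    and partial: "C \<subseteq> A" "inj_on g C" "g ` C \<subseteq> B"
  shows "\<exists>f. bij_betw f A B \<and> (\<forall>c\<in>C. f c = g c)"
proof -
  have "card (A - C) = card (B - g ` C)"
    using sets partial by (simp add: card_Diff_subset finite_subset card_image)
  then obtain h where rest: "bij_betw h (A - C) (B - g ` C)"
    using sets by (meson finite_Diff finite_same_card_bij)
  have "bij_betw (\<lambda>a. if a \<in> C then g a else h a) (C \<union> (A - C)) (g ` C \<union> (B - g ` C))"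
    using partial(2) rest by (intro bij_betw_disjoint_Un) (auto simp: bij_betw_def)
  moreover have "C \<union> (A - C) = A" "g ` C \<union> (B - g ` C) = B"
    using partial by auto
  ultimately show ?thesis
    by (intro exI[of _ "\<lambda>a. if a \<in> C then g a else h a"]) simp
qed

lemma path_turning_point:
  assumes parent: "parent_map G z p" and path: "path_in G d v"
  obtains i where "i \<le> d" "\<And>j. j < i \<Longrightarrow> v j \<noteq> z \<and> p (v j) = v (Suc j)"
    "\<And>j. i \<le> j \<Longrightarrow> j < d \<Longrightarrow> v (Suc j) \<noteq> z \<and> p (v (Suc j)) = v j"
proof -
  define descends where "descends j \<longleftrightarrow> d \<le> j \<or> v (Suc j) \<noteq> z \<and> p (v (Suc j)) = v j" for j
  define i where "i = (LEAST j. descends j)"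
  have ascends: "v j \<noteq> z \<and> p (v j) = v (Suc j)" if "\<not> descends j" for j
    using that path parent_map_arc_iff[OF parent, of "v j" "v (Suc j)"]
    by (auto simp: descends_def path_in_def)
  have "descends d"
    by (simp add: descends_def)
  then have "descends i" "i \<le> d"
    unfolding i_def by (rule LeastI, rule Least_le)
  have "descends j" if "i \<le> j" for j
    using that
  proof (induction j rule: dec_induct)
    case (step j)
    show ?case
    proof (rule ccontr)
      assume stop: "\<not> descends (Suc j)"
      then have "Suc j < d"
        by (simp add: descends_def)
      moreover have "p (v (Suc j)) = v (Suc (Suc j))"
        using ascends[OF stop] by simp
      moreover have "p (v (Suc j)) = v j"
        using step.IH \<open>Suc j < d\<close> by (simp add: descends_def)
      ultimately show False
        using path by (auto simp: path_in_def dest!: inj_onD)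
    qed
  qed (rule \<open>descends i\<close>)
  moreover have "\<not> descends j" if "j < i" for j
    using that not_less_Least unfolding i_def by blast
  ultimately show thesis
    using that[OF \<open>i \<le> d\<close>] ascends by (meson descends_def not_le)
qed

lemma ex_broom_centre:
  assumes parent: "parent_map G z p" and path: "path_in G d v" and "2 \<le> d"
  obtains c where "c \<le> d"
    "\<And>j. j \<le> d \<Longrightarrow> j \<noteq> c \<Longrightarrow> broom_parent d c c j \<noteq> c \<Longrightarrow>
      v j \<noteq> z \<and> v (broom_parent d c c j) \<noteq> z \<and> p (v j) = v (broom_parent d c c j)"
proof -
  obtain i where "i \<le> d" and ascent: "\<And>j. j < i \<Longrightarrow> v j \<noteq> z \<and> p (v j) = v (Suc j)"
    and descent: "\<And>j. i \<le> j \<Longrightarrow> j < d \<Longrightarrow> v (Suc j) \<noteq> z \<and> p (v (Suc j)) = v j"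
    using path_turning_point[OF parent path] by blast
  \<comment> \<open>If the turning point is an end of the path, the inner vertex next to it serves equally well:
    only the parents of the \<open>v j\<close> at distance at least 2 from the centre matter.\<close>
  define c where "c = max 1 (min (d - 1) i)"
  have centre: "c < d" "2 \<le> c \<Longrightarrow> c \<le> i" "c + 2 \<le> d \<Longrightarrow> i \<le> c"
    using \<open>2 \<le> d\<close> \<open>i \<le> d\<close> by (auto simp: c_def)
  have "v j \<noteq> z \<and> v (broom_parent d c c j) \<noteq> z \<and> p (v j) = v (broom_parent d c c j)"
    if "j \<le> d" and non_centre: "j \<noteq> c" "broom_parent d c c j \<noteq> c" for j
  proof -
    consider "Suc j < c" | k where "j = Suc (Suc k)" "c \<le> k"
      using non_centre \<open>j \<le> d\<close>
      by (cases j; cases "j - 1") (auto simp: broom_parent_def split: if_splits)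
    then show ?thesis
    proof cases
      case 1
      then show ?thesis
        using centre ascent[of j] ascent[of "Suc j"] by (simp add: broom_parent_def)
    next
      case 2
      then show ?thesis
        using centre \<open>j \<le> d\<close> descent[of k] descent[of "Suc k"] by (simp add: broom_parent_def)
    qed
  qed
  then show thesis
    using that[of c] centre(1) by simp
qed

lemma (in pair_graph) ex_broom_placement:
  assumes parent: "parent_map G z p" and path: "path_in G d v" and "2 \<le> d"
  obtains c f where "c \<le> d" "bij_betw f {0..<card (pverts G)} (pverts G)" "f c = z"
    "\<And>j. j \<noteq> c \<Longrightarrow> broom_parent d c c j \<noteq> c \<Longrightarrow> p (f j) = f (broom_parent d c c j)"
proof -
  obtain c where "c \<le> d" and along_path: "\<And>j. j \<le> d \<Longrightarrow> j \<noteq> c \<Longrightarrow> broom_parent d c c j \<noteq> c \<Longrightarrow>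
      v j \<noteq> z \<and> v (broom_parent d c c j) \<noteq> z \<and> p (v j) = v (broom_parent d c c j)"
    using ex_broom_centre[OF parent path \<open>2 \<le> d\<close>] by blast
  define C where "C = insert c {j. j \<le> d \<and> j \<noteq> c \<and> v j \<noteq> z}"
  define g where "g j = (if j = c then z else v j)" for j
  have "C \<subseteq> {0..<card (pverts G)}"
    using \<open>c \<le> d\<close> path_in_length_less[OF path] by (auto simp: C_def)
  moreover have "inj_on g C" "g ` C \<subseteq> pverts G"
    using path parent by (auto simp: C_def g_def path_in_def parent_map_def inj_on_def)
  ultimately obtain f where bij: "bij_betw f {0..<card (pverts G)} (pverts G)"
    and f_on_C: "\<And>j. j \<in> C \<Longrightarrow> f j = g j"
    using bij_betw_extend[of "{0..<card (pverts G)}" "pverts G" C g] pair_finite_verts by auto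
  have "p (f j) = f (broom_parent d c c j)" if non_centre: "j \<noteq> c" "broom_parent d c c j \<noteq> c" for j
  proof -
    have "j \<le> d" "broom_parent d c c j \<le> d"
      using non_centre \<open>c \<le> d\<close> by (auto simp: broom_parent_def split: if_splits)
    then show ?thesis
      using along_path[OF _ non_centre] non_centre by (simp add: f_on_C C_def g_def)
  qed
  moreover have "f c = z"
    using f_on_C[of c] by (simp add: C_def g_def)
  ultimately show thesis
    using that[of c f] \<open>c \<le> d\<close> bij by simp
qed

lemma undirected_tree_rho_dominated_by_broom:
  assumes alpha: "0 \<le> \<alpha>" "\<alpha> < 1" and tree: "undirected_tree T" and path: "path_in T d v" and "2 \<le> d"
  obtains c where "c \<le> d" "rho_dominated \<alpha> T (broom (card (pverts T)) d c)"
proof -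
  interpret pair_graph T
    using tree by (simp add: undirected_tree_def)
  have size: "d < card (pverts T)"
    by (rule path_in_length_less[OF path])
  then have nonempty: "pverts T \<noteq> {}"
    by auto
  have "(u, w) \<in> (parcs T)\<^sup>*" if "u \<in> pverts T" "w \<in> pverts T" for u w
    using reachable_rtranclI[OF undirected_tree_reachable[OF tree that]] by simp
  then obtain x where perron: "perron_vector \<alpha> T x"
    using ex_perron_vector[OF alpha nonempty] by blast
  obtain z where "is_arg_min (\<lambda>w. - x w) (\<lambda>w. w \<in> pverts T) z"
    using ex_is_arg_min_if_finite[OF pair_finite_verts nonempty] by blast
  then have maximal: "z \<in> pverts T" "\<And>w. w \<in> pverts T \<Longrightarrow> x w \<le> x z"
    by (simp_all add: is_arg_min_linorder)
  obtain p where parent: "parent_map T z p"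
    using undirected_tree_parent_map[OF tree maximal(1)] .
  obtain c f where centre: "c \<le> d"
    and placement: "bij_betw f {0..<card (pverts T)} (pverts T)" "f c = z"
    and parents: "\<And>j. j \<noteq> c \<Longrightarrow> broom_parent d c c j \<noteq> c \<Longrightarrow> p (f j) = f (broom_parent d c c j)"
    using ex_broom_placement[OF parent path \<open>2 \<le> d\<close>] by metis
  interpret parent_redirection T "broom (card (pverts T)) d c" \<alpha> x z p c "broom_parent d c c" f
  proof (rule parent_redirection.intro)
    show "pair_graph (broom (card (pverts T)) d c)"
      "parent_map (broom (card (pverts T)) d c) c (broom_parent d c c)"
      using size centre by (auto intro: pair_graph_broom parent_map_broom)
    fix j assume nonroot: "j \<in> pverts (broom (card (pverts T)) d c) - {c}"
    then have "f j \<in> pverts T - {z}"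
      using placement centre size bij_betw_apply[OF placement(1), of j]
        inj_on_eq_iff[OF bij_betw_imp_inj_on[OF placement(1)], of j c]
      by auto
    then have "x (p (f j)) \<le> x z"
      using parent by (intro maximal(2)) (auto simp: parent_map_def)
    then show "p (f j) = f (broom_parent d c c j) \<or> broom_parent d c c j = c \<and> x (p (f j)) \<le> x z"
      using parents[of j] nonroot by auto
  qed (use alpha perron parent placement pair_graph in simp_all)
  show thesis
    using centre rho_dominated by (rule that)
qed

theorem theorem3p7:
  fixes T :: "'a pair_pre_digraph" and n d :: nat and \<alpha> :: real
  assumes "undirected_tree T"
    and "card (pverts T) = n"
    and "graph_diameter T = ereal (real d)"
    and "3 \<le> d"
    and "0 \<le> \<alpha>" and "\<alpha> < 1"
  shows "rho \<alpha> T \<le> rho \<alpha> (T_tree n d) \<and>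
    (rho \<alpha> T = rho \<alpha> (T_tree n d) \<longleftrightarrow>
       digraph_iso (with_proj T) (with_proj (T_tree n d)))"
proof -
  interpret pair_graph T
    using assms(1) by (simp add: undirected_tree_def)
  obtain v where path: "path_in T d v"
    using undirected_tree_path_of_diameter[OF assms(1,3)] .
  have "2 \<le> d" and size: "d < n"
    using assms(2,4) path_in_length_less[OF path] by auto
  obtain c where centre: "c \<le> d" and above_broom: "rho_dominated \<alpha> T (broom n d c)"
    using undirected_tree_rho_dominated_by_broom[OF assms(5,6,1) path \<open>2 \<le> d\<close>] assms(2) by blast
  have "rho_dominated \<alpha> T (T_tree n d)"
    unfolding T_tree_eq_broom
    using above_broom rho_dominated_broom_central[OF assms(5,6) centre size]
    by (rule rho_dominated_trans)
  moreover have "pair_graph (T_tree n d)"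
    unfolding T_tree_eq_broom using size by (intro pair_graph_broom) auto
  ultimately show ?thesis
    using rho_digraph_iso[of T "T_tree n d" \<alpha>] pair_graph by (auto simp: rho_dominated_def)
qed

end
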